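(* For all integers $n\geq 0$ and all real $x$ with $0<x<\pi/2$, $$\sum_{k=0}^n\frac{1}{k!}\Bigl(\frac12\Bigr)_k\frac{P_{4k+1}^{(-1/2,-1/2)}(\cos(x))}{P_{4k+1}^{(-1/2,-1/2)}(1)}\geq\frac{\alpha(\pi-2x)^2}{2\cos(x)},$$ where $\alpha=\min_{0\leq t<\pi}\frac{T_6(t)}{(t-\pi)^2}=0.12290\ldots$.
   Context: For integers $k\geq 0$ set $b_{2k}=b_{2k+1}=\frac{1}{4^k}\binom{2k}{k}$, and let $T_6(x)=\sum_{k=0}^6 b_k\cos(kx)$. The Pochhammer symbol is $(a)_0=1$, $(a)_n=\prod_{k=0}^{n-1}(a+k)$ for $n\geq 1$. The Jacobi polynomials are $$P_m^{(a,b)}(z)=\frac{(a+1)_m}{m!}\sum_{k=0}^m\frac{(-m)_k(m+a+b+1)_k}{k!\,(a+1)_k}\Bigl(\frac{1-z}{2}\Bigr)^k.$$ The notation $0.12290\ldots$ means that the decimal expansion begins with these digits, i.e. $0.12290\leq\alpha<0.12291$. *)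

theory Defs
  imports "HOL-Analysis.Analysis"
begin

definition b_coeff :: "nat \<Rightarrow> real" where
  "b_coeff k = 1 / 4 ^ (k div 2) * real ((2 * (k div 2)) choose (k div 2))"

lemma b_coeff_even: "b_coeff (2 * k) = 1 / 4 ^ k * real ((2 * k) choose k)"
  and b_coeff_odd: "b_coeff (2 * k + 1) = 1 / 4 ^ k * real ((2 * k) choose k)"
  by (simp_all add: b_coeff_def)

definition T6 :: "real \<Rightarrow> real" where
  "T6 x = (\<Sum>k=0..6. b_coeff k * cos (real k * x))"

definition jacobi_P :: "nat \<Rightarrow> real \<Rightarrow> real \<Rightarrow> real \<Rightarrow> real" where
  "jacobi_P m \<alpha> \<beta> z =
     pochhammer (\<alpha> + 1) m / fact m *
     (\<Sum>k=0..m. pochhammer (- real m) k * pochhammer (real m + \<alpha> + \<beta> + 1) k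
                / (fact k * pochhammer (\<alpha> + 1) k) * ((1 - z) / 2) ^ k)"

definition is_minimum_on :: "real \<Rightarrow> ('a \<Rightarrow> real) \<Rightarrow> 'a set \<Rightarrow> bool" where
  "is_minimum_on c f S \<longleftrightarrow> c \<in> f ` S \<and> (\<forall>t\<in>S. c \<le> f t)"

end

theory Submission
  imports Defs
begin

text \<open>The normalized Jacobi polynomial is \<open>cos (m x)\<close>, so with \<open>a\<^sub>j = (1/2)\<^sub>j / j!\<close> the claim
  concerns \<open>\<Sum>j\<le>n. a\<^sub>j cos ((4j+1)x)\<close>; multiplied by \<open>2 cos x\<close> this sum becomes
  \<open>\<Sum>k\<le>2n+1. b\<^sub>k cos (2kx)\<close>. The constant \<open>0.123\<close> slightly exceeds the minimum and still works
  for all \<open>n\<close>, because an odd number \<open>2n+1\<close> never equals the critical index \<open>6\<close>.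

  For \<open>n < 8\<close>, and for \<open>T\<^sub>6\<close> itself, \<open>(\<pi> - y)\<^sup>2\<close> is convex as a function of \<open>c = cos y\<close>. Between
  suitable knots it lies below its chord, which reduces the inequality to polynomial inequalities in \<open>c\<close>
  on small intervals.

  For \<open>n \<ge> 8\<close>, the infinite series has the value \<open>1 / (2 sqrt (sin 2x))\<close> and two Abel summations bound
  the tail. This suffices as soon as the phase \<open>(4n+5)x\<close> has passed the first trough of the cosine; before
  that, passing to a larger \<open>n\<close> only decreases the sum.\<close>

section \<open>Jacobi polynomials with parameters -1/2\<close>

text \<open>With \<open>w = (1 - cos x) / 2\<close>, hence \<open>2 * cos x = 2 - 4 * w\<close>,
  this is the Chebyshev recurrence for cos (M x) compared at the power \<open>w^(k+1)\<close>. The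
  factor on the right is 4 times the quotient of the hypergeometric denominators at
  \<open>k + 1\<close> and \<open>k\<close>.\<close>

lemma hyper_coeff_recurrence:
  fixes M :: real
  defines "e \<equiv> \<lambda>M k. pochhammer (- M) k * pochhammer M k"
  shows "e (M + 1) (Suc k) + e (M - 1) (Suc k) - 2 * e M (Suc k) =
    - (4 * real k + 4) * (real k + 1/2) * e M k"
proof (cases k)
  case (Suc j)
  \<comment> \<open>Every product below contains the factor \<open>D\<close>; what remains is a
    polynomial identity in \<open>M\<close> and \<open>j\<close>.\<close>
  define D where "D = pochhammer (1 - M) j * pochhammer (M + 1) j"
  have e1: "e M (Suc j) = - M * M * D"
    by (simp add: e_def D_def pochhammer_rec algebra_simps)
  have e2: "e M (Suc (Suc j)) = - M * M * (real j + 1 - M) * (M + real j + 1) * D"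
    by (simp add: e_def D_def pochhammer_rec[of _ "Suc j"] pochhammer_rec'[of _ j] algebra_simps)
  have p1: "pochhammer (- (M + 1)) (Suc (Suc j)) = (- M - 1) * (- M) * pochhammer (1 - M) j"
    using pochhammer_rec[of "- (M + 1)" "Suc j"] pochhammer_rec[of "- M" j] by (simp add: algebra_simps)
  have p2: "pochhammer (M + 1) (Suc (Suc j)) = (M + real j + 1) * (M + real j + 2) * pochhammer (M + 1) j"
    using pochhammer_rec'[of "M + 1" "Suc j"] pochhammer_rec'[of "M + 1" j] by (simp add: algebra_simps)
  have e3: "e (M + 1) (Suc (Suc j)) = (M + 1) * M * (M + real j + 1) * (M + real j + 2) * D"
    unfolding e_def p1 p2 D_def by (simp add: algebra_simps)
  have p3: "pochhammer (M - 1) (Suc (Suc j)) = (M - 1) * M * pochhammer (M + 1) j"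
    using pochhammer_rec[of "M - 1" "Suc j"] pochhammer_rec[of "M" j] by (simp add: algebra_simps)
  have p4: "pochhammer (- (M - 1)) (Suc (Suc j)) = (real j + 1 - M) * (real j + 2 - M) * pochhammer (1 - M) j"
    using pochhammer_rec'[of "1 - M" "Suc j"] pochhammer_rec'[of "1 - M" j] by (simp add: algebra_simps)
  have e4: "e (M - 1) (Suc (Suc j)) = (M - 1) * M * (real j + 1 - M) * (real j + 2 - M) * D"
    unfolding e_def p3 p4 D_def by (simp add: algebra_simps)
  show ?thesis
    unfolding Suc e1 e2 e3 e4 by (simp add: algebra_simps)
qed (simp add: e_def algebra_simps)

definition hyper_term :: "real \<Rightarrow> nat \<Rightarrow> real" where
  "hyper_term M k = pochhammer (- M) k * pochhammer M k / (fact k * pochhammer (1 / 2) k)"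

lemma hyper_term_0 [simp]: "hyper_term M 0 = 1"
  by (simp add: hyper_term_def)

lemma hyper_term_eq_0: "m < k \<Longrightarrow> hyper_term (real m) k = 0"
  using pochhammer_of_nat_eq_0_lemma[of m k, where 'a = real] by (simp add: hyper_term_def)

lemma hyper_term_recurrence:
  "hyper_term (M + 1) (Suc k) = 2 * hyper_term M (Suc k) - hyper_term (M - 1) (Suc k) - 4 * hyper_term M k"
proof -
  define d where "d = fact k * pochhammer (1 / 2 :: real) k"
  have "d \<noteq> 0"
    using pochhammer_pos[of "1 / 2 :: real" k] by (simp add: d_def)
  have d': "fact (Suc k) * pochhammer (1 / 2 :: real) (Suc k) = (real k + 1) * (real k + 1/2) * d"
    by (simp add: d_def pochhammer_rec' algebra_simps)
  have "(real k + 1) * (real k + 1/2) \<noteq> 0"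
    by (simp add: add_nonneg_eq_0_iff)
  then show ?thesis
    unfolding hyper_term_def d' d_def [symmetric]
    using hyper_coeff_recurrence[of M k] \<open>d \<noteq> 0\<close>
    by (simp add: divide_simps) (simp add: algebra_simps)
qed

text \<open>Terms beyond \<open>m\<close> vanish, so the range \<open>K\<close> can be chosen
  independently of \<open>m\<close>. The induction needs this to compare three consecutive degrees
  over one common range.\<close>

lemma sum_hyper_term_eq_cos:
  assumes "m \<le> K"
  shows "(\<Sum>k\<le>K. hyper_term (real m) k * ((1 - cos x) / 2) ^ k) = cos (real m * x)"
  using assms
proof (induction m rule: less_induct)
  case (less m)
  define w where "w = (1 - cos x) / 2"
  consider "m = 0" | "m = 1" | j where "m = Suc (Suc j)"
    by (metis One_nat_def not0_implies_Suc)
  then show ?case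
  proof cases
    case 1
    have "(\<Sum>k\<le>K. hyper_term 0 k * w ^ k) = (\<Sum>k\<in>{0}. hyper_term 0 k * w ^ k)"
      using hyper_term_eq_0[of 0] by (intro sum.mono_neutral_right) auto
    then show ?thesis
      using 1 by (simp add: w_def)
  next
    case 2
    have "(\<Sum>k\<le>K. hyper_term 1 k * w ^ k) = (\<Sum>k\<in>{0, 1}. hyper_term 1 k * w ^ k)"
      using hyper_term_eq_0[of 1] less.prems 2 by (intro sum.mono_neutral_right) auto
    also have "\<dots> = cos x"
      by (simp add: hyper_term_def w_def field_simps)
    finally show ?thesis
      using 2 by (simp add: w_def)
  next
    case 3
    obtain K' where K: "K = Suc K'"
      using less.prems 3 by (cases K) auto
    define F where "F M = (\<Sum>k\<le>K. hyper_term M k * w ^ k)" for M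
    have F_Suc: "F M = 1 + (\<Sum>k\<le>K'. hyper_term M (Suc k) * w ^ Suc k)" for M
      unfolding F_def K by (subst sum.atMost_Suc_shift) simp
    \<comment> \<open>The top term, at \<open>k = K\<close>, vanishes because
      \<open>Suc j < m\<close> and \<open>m <= K\<close>.\<close>
    have F1: "F (real (Suc j)) = (\<Sum>k\<le>K'. hyper_term (real (Suc j)) k * w ^ k)"
      unfolding F_def using hyper_term_eq_0[of "Suc j" K] less.prems 3 by (simp add: K)
    have "F (real (Suc j) + 1) = 2 * F (real (Suc j)) - F (real (Suc j) - 1) -
        4 * w * (\<Sum>k\<le>K'. hyper_term (real (Suc j)) k * w ^ k)"
      unfolding F_Suc hyper_term_recurrence
      by (simp add: algebra_simps sum.distrib sum_subtractf sum_distrib_left)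
    then have "F (real m) = (2 - 4 * w) * F (real (Suc j)) - F (real j)"
      unfolding F1 [symmetric] using 3 by (simp add: algebra_simps)
    also have "\<dots> = 2 * cos x * cos (real (Suc j) * x) - cos (real j * x)"
    proof -
      have "F (real (Suc j)) = cos (real (Suc j) * x)" "F (real j) = cos (real j * x)"
        unfolding F_def w_def using less.prems 3 by (intro less.IH; simp)+
      moreover have "2 - 4 * w = 2 * cos x"
        by (simp add: w_def field_simps)
      ultimately show ?thesis
        by simp
    qed
    also have "\<dots> = cos (real m * x)"
      using cos_add[of "real (Suc j) * x" x] cos_diff[of "real (Suc j) * x" x] 3
      by (simp add: algebra_simps)
    finally show ?thesis
      by (simp add: F_def w_def)
  qed
qed

text \<open>For these parameters the series is the one just summed, up to a prefactor
  \<open>C\<close> independent of the argument; \<open>C\<close> cancels since 1 = cos 0.\<close>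

lemma jacobi_P_half_ratio:
  "jacobi_P m (- 1 / 2) (- 1 / 2) (cos x) / jacobi_P m (- 1 / 2) (- 1 / 2) 1 = cos (real m * x)"
proof -
  define C where "C = pochhammer (1 / 2 :: real) m / fact m"
  have "C \<noteq> 0"
    using pochhammer_pos[of "1 / 2 :: real" m] by (simp add: C_def)
  have "jacobi_P m (- 1 / 2) (- 1 / 2) (cos y) = C * cos (real m * y)" for y
    using sum_hyper_term_eq_cos[of m m y]
    by (simp add: jacobi_P_def hyper_term_def C_def atLeast0AtMost)
  from this[of x] this[of 0] \<open>C \<noteq> 0\<close> show ?thesis
    by simp
qed

section \<open>Tail of the infinite series\<close>

text \<open>These are the Taylor coefficients of (1 - z)^(-1/2), that is, the central binomial
  coefficients divided by \<open>4^j\<close>.\<close>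

definition acoef :: "nat \<Rightarrow> real" where
  "acoef j = pochhammer (1 / 2) j / fact j"

lemma acoef_0 [simp]: "acoef 0 = 1"
  by (simp add: acoef_def)

lemma acoef_Suc: "acoef (Suc j) = (2 * real j + 1) / (2 * real j + 2) * acoef j"
  by (simp add: acoef_def pochhammer_rec' field_simps)

lemma acoef_pos: "0 < acoef j"
  using pochhammer_pos[of "1 / 2 :: real" j] by (simp add: acoef_def)

lemma acoef_diff: "acoef j - acoef (Suc j) = acoef j / (2 * (real j + 1))"
  by (simp add: acoef_Suc field_simps)

lemma acoef_antimono: "decseq acoef"
  using acoef_pos by (intro decseq_SucI) (smt (verit) acoef_diff divide_nonneg_pos of_nat_0_le_iff)

lemma acoef_le_1: "acoef j \<le> 1"
  using decseqD[OF acoef_antimono, of 0 j] by simp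

text \<open>Convexity of the coefficients, which the second summation by parts requires. By
  \<open>acoef_diff\<close> a difference is a decreasing numerator over an increasing
  denominator.\<close>

lemma acoef_diff_antimono: "decseq (\<lambda>j. acoef j - acoef (Suc j))"
  unfolding acoef_diff
  using acoef_pos decseqD[OF acoef_antimono]
  by (intro decseq_SucI frac_le) (auto intro: less_imp_le)

text \<open>Two summations by parts; the second differences are nonnegative and telescope.\<close>
lemma abel_tail_bound:
  fixes c :: "nat \<Rightarrow> real" and w :: complex
  assumes c: "\<And>j. 0 \<le> c j" "\<And>j. c (Suc j) \<le> c j"
    and d: "\<And>j. c (Suc j) - c (Suc (Suc j)) \<le> c j - c (Suc j)"
    and w: "norm w = 1" "w \<noteq> 1" and summable: "summable c"
  shows "norm (\<Sum>j. of_real (c j) * w ^ j) \<le> (c 0 + 2 * (c 0 - c 1) / norm (1 - w)) / norm (1 - w)"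
proof -
  define F where "F e = (\<Sum>j. complex_of_real (e j) * w ^ j)" for e
  define D where "D e j = e j - e (Suc j)" for e :: "nat \<Rightarrow> real" and j
  have D_summable: "summable (D e)" if "summable e" for e
    unfolding D_def using that by (intro summable_diff) (simp_all add: summable_Suc_iff)
  have cplx: "summable (\<lambda>j. complex_of_real (e j) * w ^ j)" if "summable e" "\<And>j. 0 \<le> e j" for e
    using that w by (intro summable_norm_cancel[where f = "\<lambda>j. complex_of_real (e j) * w ^ j"])
      (simp add: norm_mult norm_power)
  \<comment> \<open>Summation by parts: multiplying by \<open>1 - w\<close> replaces the
    coefficients by their differences. It is applied to \<open>D c\<close> first and then to
    \<open>c\<close>.\<close>
  have step: "(1 - w) * F e = e 0 - w * F (D e)" if e: "summable e" "\<And>j. 0 \<le> e j" "\<And>j. e (Suc j) \<le> e j" for e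
  proof -
    have D: "summable (\<lambda>j. complex_of_real (D e j) * w ^ j)"
      using e by (intro cplx D_summable) (auto simp: D_def)
    have shifted: "summable (\<lambda>j. complex_of_real (e (Suc j)) * w ^ j)"
      using e by (intro cplx) (auto simp: summable_Suc_iff)
    have "F e = e 0 + (\<Sum>j. complex_of_real (e (Suc j)) * w ^ Suc j)"
      unfolding F_def using suminf_split_head[OF cplx[OF e(1,2)]] by simp
    also have "(\<Sum>j. complex_of_real (e (Suc j)) * w ^ Suc j) = w * (\<Sum>j. complex_of_real (e (Suc j)) * w ^ j)"
      using shifted by (simp add: suminf_mult mult.left_commute)
    also have "(\<Sum>j. complex_of_real (e (Suc j)) * w ^ j) = F e - F (D e)"
      unfolding F_def using cplx[OF e(1,2)] D
      by (subst suminf_diff) (simp_all add: D_def algebra_simps)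
    finally show ?thesis
      by (simp add: algebra_simps)
  qed
  have F_bound: "norm (F e) \<le> suminf e" if "summable e" "\<And>j. 0 \<le> e j" for e
  proof -
    have "norm (F e) \<le> (\<Sum>j. norm (complex_of_real (e j) * w ^ j))"
      unfolding F_def using that w by (intro summable_norm) (simp add: norm_mult norm_power)
    then show ?thesis
      using that w by (simp add: norm_mult norm_power)
  qed
  have tele: "suminf (D e) = e 0" if "summable e" for e
  proof -
    have "(\<lambda>j. e j - e (Suc j)) sums (e 0 - 0)"
      by (rule telescope_sums') (use that summable_LIMSEQ_zero in blast)
    then show ?thesis
      by (simp add: D_def[abs_def] sums_iff)
  qed
  define r where "r = norm (1 - w)"
  have r: "0 < r"
    using w by (simp add: r_def)
  have Dc: "summable (D c)" "\<And>j. 0 \<le> D c j" "\<And>j. D c (Suc j) \<le> D c j"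
    using D_summable[OF summable] c d by (auto simp: D_def)
  have "r * norm (F (D c)) = norm (D c 0 - w * F (D (D c)))"
    using step[OF Dc] by (simp add: r_def flip: norm_mult)
  also have "\<dots> \<le> norm (complex_of_real (D c 0)) + norm (w * F (D (D c)))"
    by (rule norm_triangle_ineq4)
  also have "\<dots> \<le> D c 0 + suminf (D (D c))"
  proof -
    have "0 \<le> D (D c) j" for j
      using Dc(3) unfolding D_def[of "D c"] by simp
    then have "norm (F (D (D c))) \<le> suminf (D (D c))"
      using F_bound D_summable[OF Dc(1)] by blast
    then show ?thesis
      using Dc(2)[of 0] w by (simp add: norm_mult)
  qed
  also have "\<dots> = 2 * D c 0"
    using tele[OF Dc(1)] by simp
  finally have 1: "norm (F (D c)) \<le> 2 * D c 0 / r"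
    using r by (simp add: field_simps)
  have "r * norm (F c) = norm (c 0 - w * F (D c))"
    using step[OF summable c] by (simp add: r_def flip: norm_mult)
  also have "\<dots> \<le> norm (complex_of_real (c 0)) + norm (w * F (D c))"
    by (rule norm_triangle_ineq4)
  also have "\<dots> \<le> c 0 + 2 * D c 0 / r"
    using 1 c(1)[of 0] w by (simp add: norm_mult)
  finally show ?thesis
    using r by (simp add: F_def D_def r_def field_simps)
qed

lemma acoef_gbinomial: "complex_of_real (acoef j) * z ^ j = (- 1 / 2 gchoose j) * (- z) ^ j"
proof -
  have "complex_of_real (pochhammer (1 / 2) j) = pochhammer (1 / 2) j"
    using pochhammer_of_real[of "1 / 2" j, where 'a = complex] by simp
  then show ?thesis
    by (cases "even j") (simp_all add: acoef_def gbinomial_pochhammer)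
qed

lemma acoef_sums:
  assumes "norm z < 1"
  shows "(\<lambda>j. complex_of_real (acoef j) * z ^ j) sums (1 - z) powr (- 1 / 2)"
  using gen_binomial_complex[of "- z" "- 1 / 2"] assms by (simp add: acoef_gbinomial)

text \<open>Replacing \<open>w\<close> by \<open>r w\<close> makes the binomial series converge absolutely; \<open>r \<rightarrow> 1\<close> is taken only in the
  final estimate.\<close>
lemma acoef_tail_bound_radial:
  fixes w :: complex
  assumes w: "norm w = 1" "w \<noteq> 1" and r: "0 \<le> r" "r < 1"
  shows "norm ((1 - of_real r * w) powr (- 1 / 2) - (\<Sum>j<m. of_real (acoef j) * (of_real r * w) ^ j))
    \<le> (r ^ m * acoef m + 2 * r ^ m * (acoef m - r * acoef (Suc m)) / norm (1 - w)) / norm (1 - w)"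
proof -
  define c where "c j = r ^ (j + m) * acoef (j + m)" for j
  have sums: "(\<lambda>j. complex_of_real (acoef j) * (of_real r * w) ^ j) sums (1 - of_real r * w) powr (- 1 / 2)"
    using r w by (intro acoef_sums) (simp add: norm_mult)
  have "(1 - of_real r * w) powr (- 1 / 2) - (\<Sum>j<m. of_real (acoef j) * (of_real r * w) ^ j) =
    (\<Sum>j. of_real (acoef (j + m)) * (of_real r * w) ^ (j + m))"
    using suminf_minus_initial_segment[OF sums_summable[OF sums], of m] sums by (simp add: sums_iff)
  also have "\<dots> = (\<Sum>j. w ^ m * (of_real (c j) * w ^ j))"
    by (simp add: c_def power_mult_distrib power_add algebra_simps)
  also have "\<dots> = w ^ m * (\<Sum>j. of_real (c j) * w ^ j)"
  proof (rule suminf_mult)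
    have "summable (\<lambda>j. w ^ m * (complex_of_real (c j) * w ^ j))"
      using summable_ignore_initial_segment[OF sums_summable[OF sums], of m]
      by (simp add: c_def power_mult_distrib power_add algebra_simps)
    then show "summable (\<lambda>j. complex_of_real (c j) * w ^ j)"
      using w by (subst (asm) summable_cmult_iff) auto
  qed
  finally have "norm ((1 - of_real r * w) powr (- 1 / 2) - (\<Sum>j<m. of_real (acoef j) * (of_real r * w) ^ j)) =
    norm (\<Sum>j. of_real (c j) * w ^ j)"
    using w by (simp add: norm_mult norm_power)
  also have "\<dots> \<le> (c 0 + 2 * (c 0 - c 1) / norm (1 - w)) / norm (1 - w)"
  proof (rule abel_tail_bound[OF _ _ _ w])
    show "0 \<le> c j" for j
      using r acoef_pos[of "j + m"] by (simp add: c_def)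
    have a1: "acoef (Suc j) \<le> acoef j" for j
      using decseqD[OF acoef_antimono] by simp
    show "c (Suc j) \<le> c j" for j
      unfolding c_def using r a1 acoef_pos[of "j + m"]
      by (intro mult_mono) (auto simp: power_decreasing mult_left_le_one_le acoef_pos less_imp_le)
    show "c (Suc j) - c (Suc (Suc j)) \<le> c j - c (Suc j)" for j
    proof -
      define a b d where "a = acoef (j + m)" and "b = acoef (Suc (j + m))" and "d = acoef (Suc (Suc (j + m)))"
      have "b - d \<le> a - b" "0 < b" "0 < d" "b \<le> a" "d \<le> b"
        using decseqD[OF acoef_diff_antimono, of "j + m" "Suc (j + m)"] a1 acoef_pos by (auto simp: a_def b_def d_def)
      \<comment> \<open>Damping by \<open>r\<close> preserves convexity: the second difference of
        the damped coefficients is a power of \<open>r\<close> times this sum of nonnegative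
        terms.\<close>
      then have "0 \<le> ((a - b) - (b - d)) + 2 * (1 - r) * (b - d) + (1 - r)\<^sup>2 * d"
        using r by (intro add_nonneg_nonneg mult_nonneg_nonneg) auto
      also have "\<dots> = a - 2 * r * b + r\<^sup>2 * d"
        by (simp add: power2_eq_square algebra_simps)
      finally have "0 \<le> r ^ (j + m) * (a - 2 * r * b + r\<^sup>2 * d)"
        using r by simp
      then show ?thesis
        by (simp add: c_def a_def b_def d_def power2_eq_square algebra_simps)
    qed
    show "summable c"
    proof (rule summable_comparison_test)
      show "summable (\<lambda>j. r ^ m * r ^ j)"
        using r by (intro summable_mult summable_geometric) auto
      have "norm (c n) \<le> r ^ m * r ^ n" for n
      proof -
        have "r ^ (n + m) * acoef (n + m) \<le> r ^ (n + m) * 1"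
          using r acoef_le_1 by (intro mult_left_mono) auto
        then show ?thesis
          using r acoef_pos[of "n + m"] by (simp add: c_def power_add abs_mult mult.commute)
      qed
      then show "\<exists>N. \<forall>n\<ge>N. norm (c n) \<le> r ^ m * r ^ n"
        by blast
    qed
  qed
  finally show ?thesis
    by (simp add: c_def algebra_simps)
qed

lemma acoef_tail_bound:
  fixes w :: complex
  assumes w: "norm w = 1" "w \<noteq> 1"
  shows "norm ((1 - w) powr (- 1 / 2) - (\<Sum>j<m. of_real (acoef j) * w ^ j))
    \<le> acoef m * (1 + 1 / ((real m + 1) * norm (1 - w))) / norm (1 - w)"
proof -
  \<comment> \<open>This keeps \<open>1 - w\<close> off the branch cut of the complex power, so the
    limit \<open>r\<close> to 1 may be taken inside it.\<close>
  have "Re w < 1"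
  proof -
    have "Re w \<le> 1"
      using complex_Re_le_cmod[of w] w by simp
    moreover have "Re w \<noteq> 1"
    proof
      assume "Re w = 1"
      then have "Im w = 0"
        using w cmod_power2[of w] by simp
      then show False
        using \<open>Re w = 1\<close> w by (simp add: complex_eq_iff)
    qed
    ultimately show ?thesis
      by simp
  qed
  then have "1 - of_real 1 * w \<notin> \<real>\<^sub>\<le>\<^sub>0"
    by (auto simp: complex_nonpos_Reals_iff)
  then have "((\<lambda>r. norm ((1 - of_real r * w) powr (- 1 / 2) - (\<Sum>j<m. of_real (acoef j) * (of_real r * w) ^ j)))
     \<longlongrightarrow> norm ((1 - of_real 1 * w) powr (- 1 / 2) - (\<Sum>j<m. of_real (acoef j) * (of_real 1 * w) ^ j))) (at_left 1)"
    by (intro tendsto_intros) auto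
  moreover have "((\<lambda>r. (r ^ m * acoef m + 2 * r ^ m * (acoef m - r * acoef (Suc m)) / norm (1 - w)) / norm (1 - w))
     \<longlongrightarrow> (1 ^ m * acoef m + 2 * 1 ^ m * (acoef m - 1 * acoef (Suc m)) / norm (1 - w)) / norm (1 - w)) (at_left 1)"
    using w by (intro tendsto_intros) auto
  moreover have "\<forall>\<^sub>F r in at_left (1 :: real). 0 < r \<and> r < 1"
    using eventually_at_left_real[of 0 "1 :: real"] by simp
  then have "\<forall>\<^sub>F r in at_left 1. norm ((1 - of_real r * w) powr (- 1 / 2) - (\<Sum>j<m. of_real (acoef j) * (of_real r * w) ^ j))
     \<le> (r ^ m * acoef m + 2 * r ^ m * (acoef m - r * acoef (Suc m)) / norm (1 - w)) / norm (1 - w)"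
    by eventually_elim (rule acoef_tail_bound_radial[OF w]; simp)
  ultimately have "norm ((1 - w) powr (- 1 / 2) - (\<Sum>j<m. of_real (acoef j) * w ^ j))
     \<le> (acoef m + 2 * (acoef m - acoef (Suc m)) / norm (1 - w)) / norm (1 - w)"
    by (intro tendsto_le[OF trivial_limit_at_left_real]) auto
  also have "\<dots> = acoef m * (1 + 1 / ((real m + 1) * norm (1 - w))) / norm (1 - w)"
  proof -
    have "2 * (acoef m - acoef (Suc m)) / norm (1 - w) = acoef m * (1 / ((real m + 1) * norm (1 - w)))"
    proof -
      have "2 * (a / (2 * p)) / N = a * (1 / (p * N))" for a p N :: real
        by simp
      then show ?thesis
        unfolding acoef_diff .
    qed
    then show ?thesis
      by (simp add: distrib_left)
  qed
  finally show ?thesis .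
qed

definition jacobi_sum :: "nat \<Rightarrow> real \<Rightarrow> real" where
  "jacobi_sum n x = (\<Sum>j\<le>n. acoef j * cos (real (4 * j + 1) * x))"

text \<open>The sum is the real part of \<open>cis x\<close> times a partial sum of the binomial
  series at \<open>w = cis (4 * x)\<close>, where the norm of \<open>1 - w\<close> is
  \<open>2 * sin (2 * x)\<close>. The full series contributes
  \<open>1 / (2 * sqrt s)\<close>.\<close>

lemma jacobi_sum_tail_bound:
  assumes x: "0 < x" "x < pi / 2"
  defines "s \<equiv> sin (2 * x)"
  shows "1 / (2 * sqrt s) - acoef (Suc n) * (1 + 1 / (2 * (real n + 2) * s)) / (2 * s) \<le> jacobi_sum n x"
proof -
  define w where "w = cis (4 * x)"
  have s: "0 < s"
    unfolding s_def using x by (intro sin_gt_zero) auto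
  have w1: "1 - w = of_real (2 * s) * cis (2 * x - pi / 2)"
  proof -
    have "cos (4 * x) = 1 - 2 * s\<^sup>2" "sin (4 * x) = 2 * s * cos (2 * x)"
      using cos_double_sin[of "2 * x"] sin_double[of "2 * x"] by (simp_all add: s_def)
    then show ?thesis
      by (simp add: w_def complex_eq_iff cos_diff sin_diff power2_eq_square flip: s_def)
  qed
  have norm_w: "norm (1 - w) = 2 * s" "norm w = 1"
    using s unfolding w1 by (simp_all add: norm_mult w_def)
  then have "w \<noteq> 1"
    using s by auto
  \<comment> \<open>The argument \<open>2 * x - pi / 2\<close> lies strictly between -pi/2 and pi/2,
    so it is the principal one. The power multiplies it by -1/2, and the later factor
    \<open>cis x\<close> leaves the fixed angle pi/4.\<close>
  have powr: "(1 - w) powr (- 1 / 2) = of_real (1 / sqrt (2 * s)) * cis (pi / 4 - x)"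
  proof -
    have ln_w: "ln (1 - w) = of_real (ln (2 * s)) + \<i> * of_real (2 * x - pi / 2)"
    proof -
      have "Ln (exp (\<i> * of_real (2 * x - pi / 2))) = \<i> * of_real (2 * x - pi / 2)"
        using x by (intro Ln_exp) auto
      moreover have "Ln (of_real (2 * s)) = of_real (ln (2 * s))"
        using s by (intro Ln_of_real) auto
      ultimately show ?thesis
        unfolding w1 cis_conv_exp using s Ln_times_of_real[of "2 * s"] by (metis exp_not_eq_zero mult_pos_pos zero_less_numeral)
    qed
    have "- 1 / 2 * ln (1 - w) = of_real (- ln (2 * s) / 2) + \<i> * of_real (pi / 4 - x)"
      unfolding ln_w by (simp add: field_simps)
    then have "(1 - w) powr (- 1 / 2) = exp (of_real (- ln (2 * s) / 2) + \<i> * of_real (pi / 4 - x))"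
      using \<open>w \<noteq> 1\<close> by (simp add: powr_def)
    also have "\<dots> = exp (of_real (- ln (2 * s) / 2)) * cis (pi / 4 - x)"
      unfolding exp_add cis_conv_exp ..
    also have "exp (complex_of_real (- ln (2 * s) / 2)) = of_real (1 / sqrt (2 * s))"
      using s by (simp add: exp_of_real ln_sqrt exp_minus field_simps flip: ln_sqrt)
    finally show ?thesis .
  qed
  have "1 / (2 * sqrt s) - jacobi_sum n x = Re (cis x * ((1 - w) powr (- 1 / 2) - (\<Sum>j<Suc n. of_real (acoef j) * w ^ j)))"
    (is "_ = Re ?d")
  proof -
    have "cis x * ((1 - w) powr (- 1 / 2)) = of_real (1 / sqrt (2 * s)) * cis (pi / 4)"
      unfolding powr by (simp add: mult.left_commute cis_mult)
    then have "Re (cis x * ((1 - w) powr (- 1 / 2))) = 1 / (2 * sqrt s)"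
      by (simp add: cos_45 real_sqrt_mult field_simps)
    moreover have "Re (cis x * (\<Sum>j<Suc n. of_real (acoef j) * w ^ j)) = jacobi_sum n x"
    proof -
      have term_eq: "cis x * (of_real (acoef j) * w ^ j) = of_real (acoef j) * cis (real (4 * j + 1) * x)" for j
      proof -
        have "cis x * w ^ j = cis x * cis (real j * (4 * x))"
          unfolding w_def Complex.DeMoivre ..
        also have "\<dots> = cis (real (4 * j + 1) * x)"
          unfolding cis_mult by (simp add: algebra_simps)
        finally show ?thesis
          by (simp add: mult.left_commute)
      qed
      show ?thesis
        unfolding sum_distrib_left Re_sum term_eq lessThan_Suc_atMost jacobi_sum_def by simp
    qed
    ultimately show ?thesis
      by (simp only: right_diff_distrib minus_complex.simps)
  qed
  also have "\<dots> \<le> norm ?d"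
    by (rule complex_Re_le_cmod)
  also have "\<dots> \<le> acoef (Suc n) * (1 + 1 / ((real (Suc n) + 1) * norm (1 - w))) / norm (1 - w)"
    using acoef_tail_bound[OF norm_w(2) \<open>w \<noteq> 1\<close>, of "Suc n"] by (simp add: norm_mult del: sum.lessThan_Suc)
  finally show ?thesis
    unfolding norm_w by (simp add: algebra_simps)
qed

section \<open>Certified lower bounds for cosine polynomials\<close>

primrec horner :: "int list \<Rightarrow> real \<Rightarrow> real" where
  "horner [] x = 0"
| "horner (a # p) x = of_int a + x * horner p x"

fun add_poly :: "int list \<Rightarrow> int list \<Rightarrow> int list" where
  "add_poly [] q = q"
| "add_poly p [] = p"
| "add_poly (a # p) (b # q) = (a + b) # add_poly p q"

definition smult_poly :: "int \<Rightarrow> int list \<Rightarrow> int list" where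
  "smult_poly c p = map ((*) c) p"

primrec shift_poly :: "int \<Rightarrow> int list \<Rightarrow> int list" where
  "shift_poly a [] = []"
| "shift_poly a (c # p) = (let q = shift_poly a p in add_poly (c # q) (smult_poly a q))"

text \<open>\<open>lower_bound H p\<close> is a lower bound of \<open>p\<close> on \<open>[0, H]\<close>: a tail \<open>h q(h)\<close> with \<open>0 \<le> h \<le> H\<close> is at least
  \<open>min 0 (H L)\<close> if \<open>L\<close> is a lower bound of \<open>q\<close>.\<close>
primrec lower_bound :: "int \<Rightarrow> int list \<Rightarrow> int" where
  "lower_bound H [] = 0"
| "lower_bound H (c # q) = c + min 0 (H * lower_bound H q)"

lemma horner_add_poly: "horner (add_poly p q) x = horner p x + horner q x"
  by (induction p q rule: add_poly.induct) (simp_all add: algebra_simps)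

lemma horner_smult_poly: "horner (smult_poly c p) x = of_int c * horner p x"
  by (induction p) (simp_all add: smult_poly_def algebra_simps)

lemma horner_shift_poly: "horner (shift_poly a p) x = horner p (of_int a + x)"
  by (induction p) (simp_all add: Let_def horner_add_poly horner_smult_poly algebra_simps)

lemma lower_bound_le_horner:
  assumes "0 \<le> h" "h \<le> of_int H"
  shows "of_int (lower_bound H p) \<le> horner p h"
proof (induction p)
  case (Cons c q)
  have "min 0 (of_int H * of_int (lower_bound H q)) \<le> h * horner q h"
  proof (cases "lower_bound H q \<ge> 0")
    case True
    then have "0 \<le> horner q h"
      using Cons by (smt (verit) of_int_0_le_iff)
    then show ?thesis
      using assms by (simp add: min.coboundedI1)
  next
    case False
    then have "of_int H * real_of_int (lower_bound H q) \<le> h * of_int (lower_bound H q)"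
      using assms by (intro mult_right_mono_neg) auto
    also have "\<dots> \<le> h * horner q h"
      using Cons assms by (intro mult_left_mono) auto
    finally show ?thesis
      by (simp add: min.coboundedI2)
  qed
  then show ?case
    by (simp add: of_int_min)
qed simp

text \<open>To keep all coefficients integral, the polynomials for cosine sums are scaled and take the argument \<open>D cos y\<close>.
  The accumulators \<open>u\<close> and \<open>v\<close> represent \<open>D^k cos (ky)\<close> and \<open>D^(k+1) cos ((k+1)y)\<close>; they follow the
  Chebyshev recurrence.\<close>
fun cos_sum_poly_aux :: "int \<Rightarrow> int list \<Rightarrow> int list \<Rightarrow> int list \<Rightarrow> int list \<Rightarrow> int list" where
  "cos_sum_poly_aux D [] u v w = w"
| "cos_sum_poly_aux D (b # bs) u v w =
     cos_sum_poly_aux D bs v (add_poly (0 # smult_poly 2 v) (smult_poly (- D * D) u))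
       (add_poly (smult_poly D w) (smult_poly b u))"

definition cos_sum_poly :: "int \<Rightarrow> int list \<Rightarrow> int list" where
  "cos_sum_poly D bs = cos_sum_poly_aux D bs [1] [0, 1] []"

lemma cos_times_Suc_Suc:
  fixes y :: real
  shows "cos (real (Suc (Suc k)) * y) = 2 * cos y * cos (real (Suc k) * y) - cos (real k * y)"
  using cos_add[of "real (Suc k) * y" y] cos_diff[of "real (Suc k) * y" y]
  by (simp add: algebra_simps)

text \<open>The running total \<open>w\<close> carries the scale \<open>D^(k-1)\<close>; multiplying
  by \<open>D\<close> states this without a negative exponent at \<open>k = 0\<close>.\<close>

lemma horner_cos_sum_poly_aux:
  assumes "horner u (of_int D * cos y) = of_int D ^ k * cos (real k * y)"
    and "horner v (of_int D * cos y) = of_int D ^ Suc k * cos (real (Suc k) * y)"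
    and "of_int D * horner w (of_int D * cos y) = of_int D ^ k * W"
  shows "of_int D * horner (cos_sum_poly_aux D bs u v w) (of_int D * cos y) =
    of_int D ^ (k + length bs) * (W + (\<Sum>j<length bs. of_int (bs ! j) * cos (real (k + j) * y)))"
  using assms
proof (induction bs arbitrary: u v w k W)
  case (Cons b bs)
  have "of_int D * horner (cos_sum_poly_aux D (b # bs) u v w) (of_int D * cos y) =
    of_int D ^ (Suc k + length bs) * (W + of_int b * cos (real k * y) +
      (\<Sum>j<length bs. of_int (bs ! j) * cos (real (Suc k + j) * y)))"
    unfolding cos_sum_poly_aux.simps
  proof (rule Cons.IH)
    show "horner (add_poly (0 # smult_poly 2 v) (smult_poly (- D * D) u)) (of_int D * cos y) =
      of_int D ^ Suc (Suc k) * cos (real (Suc (Suc k)) * y)"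
      unfolding cos_times_Suc_Suc using Cons.prems
      by (simp add: horner_add_poly horner_smult_poly algebra_simps)
    show "of_int D * horner (add_poly (smult_poly D w) (smult_poly b u)) (of_int D * cos y) =
      of_int D ^ Suc k * (W + of_int b * cos (real k * y))"
      using Cons.prems by (simp add: horner_add_poly horner_smult_poly algebra_simps)
  qed (use Cons.prems in auto)
  then show ?case
    by (simp only: sum.lessThan_Suc_shift list.size nth_Cons_0 nth_Cons_Suc add_Suc add_Suc_right add_0_right
        add.assoc o_def)
qed simp

lemma horner_cos_sum_poly:
  assumes "D \<noteq> 0"
  shows "horner (cos_sum_poly D (b # bs)) (of_int D * cos y) =
    of_int D ^ length bs * (\<Sum>j\<le>length bs. of_int ((b # bs) ! j) * cos (real j * y))"
proof -
  have "of_int D * horner (cos_sum_poly D (b # bs)) (of_int D * cos y) =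
    of_int D ^ (0 + length (b # bs)) *
      (0 + (\<Sum>j<length (b # bs). of_int ((b # bs) ! j) * cos (real (0 + j) * y)))"
    unfolding cos_sum_poly_def by (rule horner_cos_sum_poly_aux) simp_all
  then show ?thesis
    using assms by (simp add: lessThan_Suc_atMost del: sum.lessThan_Suc sum.atMost_Suc nth_Cons_Suc)
qed

section \<open>Chord bounds for the squared arccosine\<close>

lemma sin_ratio_antimono:
  fixes a b :: real
  assumes "0 < a" "a < b" "b < pi"
  shows "sin b * a \<le> sin a * b"
proof -
  \<comment> \<open>Since cosine decreases, the mean slope of sine over \<open>[0, a]\<close> is at
    least that over \<open>[a, b]\<close>; this is the decrease of sin t / t.\<close>
  obtain u where u: "0 < u" "u < a" "sin a - sin 0 = (a - 0) * cos u"
    using MVT2[of 0 a sin cos] assms DERIV_sin by auto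
  obtain v where v: "a < v" "v < b" "sin b - sin a = (b - a) * cos v"
    using MVT2[of a b sin cos] assms DERIV_sin by auto
  have "cos v \<le> cos u"
    using u v assms by (intro cos_monotone_0_pi_le) auto
  then have "a * ((b - a) * cos v) \<le> (b - a) * (a * cos u)"
    using assms by (simp add: mult_left_mono)
  then have "a * (sin b - sin a) \<le> (b - a) * sin a"
    using u v by simp
  then show ?thesis
    by (simp add: algebra_simps)
qed

text \<open>With \<open>s = arccos (- c)\<close>, the derivative of chord minus \<open>s\<^sup>2\<close> is \<open>sin s (B - 2s / sin s)\<close>, which changes sign at
  most once, from plus to minus.\<close>
lemma arccos_square_le_chord:
  assumes "- 1 \<le> c0" "c0 < c1" "c1 \<le> 1" "c0 \<le> c" "c \<le> c1"
    and r0: "arccos (- c0) \<le> r0" and r1: "arccos (- c1) \<le> r1"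
  shows "(arccos (- c))\<^sup>2 \<le> r0\<^sup>2 + (r1\<^sup>2 - r0\<^sup>2) * (c - c0) / (c1 - c0)"
proof -
  define B where "B = (r1\<^sup>2 - r0\<^sup>2) / (c1 - c0)"
  define h where "h s = r0\<^sup>2 + B * (- cos s - c0) - s\<^sup>2" for s
  define p q s where "p = arccos (- c0)" and "q = arccos (- c1)" and "s = arccos (- c)"
  have ps: "p \<le> s" and sq: "s \<le> q" and p0: "0 \<le> p" and qpi: "q \<le> pi"
    unfolding p_def q_def s_def using assms by (auto intro!: arccos_le_arccos arccos_lbound arccos_ubound)
  have hp: "0 \<le> h p"
    using r0 p0 assms by (simp add: h_def p_def power_mono)
  have hq: "0 \<le> h q"
  proof -
    have "h q = r1\<^sup>2 - q\<^sup>2"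
      using assms by (simp add: h_def q_def B_def)
    then show ?thesis
      using r1 p0 ps sq by (simp add: q_def power_mono)
  qed
  have deriv: "(h has_real_derivative B * sin t - 2 * t) (at t)" for t
    unfolding h_def by (auto intro!: derivative_eq_intros)
  have "0 \<le> h s"
  proof (rule ccontr)
    \<comment> \<open>A negative value between two nonnegative end values forces a negative
      derivative at some \<open>t1\<close> and a positive one at a later \<open>t2\<close>, which
      the decrease of sin t / t excludes.\<close>
    assume neg: "\<not> 0 \<le> h s"
    then have "p < s" "s < q"
      using ps sq hp hq by (auto simp: order_less_le)
    obtain t1 where t1: "p < t1" "t1 < s" "h s - h p = (s - p) * (B * sin t1 - 2 * t1)"
      using MVT2[OF \<open>p < s\<close>, of h "\<lambda>t. B * sin t - 2 * t"] deriv by blast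
    obtain t2 where t2: "s < t2" "t2 < q" "h q - h s = (q - s) * (B * sin t2 - 2 * t2)"
      using MVT2[OF \<open>s < q\<close>, of h "\<lambda>t. B * sin t - 2 * t"] deriv by blast
    have "B * sin t1 < 2 * t1"
    proof -
      have "(s - p) * (B * sin t1 - 2 * t1) < 0"
        using neg hp t1(3) by linarith
      then show ?thesis
        using \<open>p < s\<close> by (simp add: mult_less_0_iff)
    qed
    have "2 * t2 < B * sin t2"
    proof -
      have "0 < (q - s) * (B * sin t2 - 2 * t2)"
        using neg hq t2(3) by linarith
      then show ?thesis
        using \<open>s < q\<close> by (simp add: zero_less_mult_iff)
    qed
    have t: "0 < t1" "t1 < t2" "t2 < pi"
      using t1 t2 p0 qpi by auto
    then have ratio: "sin t2 * t1 \<le> sin t1 * t2"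
      by (intro sin_ratio_antimono) auto
    have B: "0 < B"
      using \<open>2 * t2 < B * sin t2\<close> t sin_gt_zero[of t2] by (smt (verit) mult_nonpos_nonneg)
    have "2 * t2 * t1 < B * sin t2 * t1"
      using \<open>2 * t2 < B * sin t2\<close> t by simp
    also have "\<dots> \<le> B * sin t1 * t2"
      using ratio B by (simp add: mult.assoc)
    also have "\<dots> < 2 * t1 * t2"
      using \<open>B * sin t1 < 2 * t1\<close> t by simp
    finally show False
      by simp
  qed
  then show ?thesis
    using assms by (simp add: h_def s_def B_def)
qed

section \<open>Rational bounds for cosine and arccosine\<close>

lemma cos_taylor_error:
  fixes x :: real
  shows "\<bar>cos x - (\<Sum>m<n. cos_coeff m * x ^ m)\<bar> \<le> \<bar>x\<bar> ^ n / fact n"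
proof -
  obtain t where "cos x = (\<Sum>m<n. cos_coeff m * x ^ m) + (cos (t + 1/2 * real n * pi) / fact n) * x ^ n"
    using Maclaurin_cos_expansion by blast
  then have "\<bar>cos x - (\<Sum>m<n. cos_coeff m * x ^ m)\<bar> = \<bar>cos (t + 1/2 * real n * pi)\<bar> * (\<bar>x\<bar> ^ n / fact n)"
    by (simp add: abs_mult power_abs)
  also have "\<dots> \<le> 1 * (\<bar>x\<bar> ^ n / fact n)"
    by (intro mult_right_mono) auto
  finally show ?thesis
    by simp
qed

text \<open>The Taylor polynomial of degree 20 in Horner form.\<close>
definition cos_upper :: "real \<Rightarrow> real" where
  "cos_upper x = (let q = x\<^sup>2 in 1 - q / 2 * (1 - q / 12 * (1 - q / 30 * (1 - q / 56 * (1 - q / 90 *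
     (1 - q / 132 * (1 - q / 182 * (1 - q / 240 * (1 - q / 306 * (1 - q / 380))))))))))"

lemma cos_upper_eq: "cos_upper x = (\<Sum>m<20. cos_coeff m * x ^ m) + x ^ 20 / fact 20"
  by (simp add: lessThan_nat_numeral cos_coeff_def cos_upper_def fact_numeral Let_def field_simps
      flip: power_add power_mult)

lemma cos_le_cos_upper: "cos x \<le> cos_upper x"
  using cos_taylor_error[of x 20] by (simp add: cos_upper_eq power_even_abs abs_le_iff)

text \<open>One copy of the degree 20 term undoes its inclusion in \<open>cos_upper\<close>, the
  other pays for the remainder.\<close>

lemma cos_ge_cos_upper: "cos_upper x - 2 * x ^ 20 / fact 20 \<le> cos x"
  using cos_taylor_error[of x 20] by (simp add: cos_upper_eq power_even_abs abs_le_iff)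

text \<open>Arccosine decreases, and \<open>3.14 < pi\<close> makes \<open>r\<close> the arccosine
  of its own cosine; only a polynomial at \<open>r\<close> has to be evaluated.\<close>

lemma arccos_le:
  assumes "cos_upper r \<le> c" "c \<le> 1" "0 \<le> r" "r \<le> 3.14"
  shows "arccos c \<le> r"
proof -
  have "r \<le> pi"
    using assms pi_approx by simp
  have "arccos c \<le> arccos (cos r)"
    using assms cos_le_cos_upper[of r] by (intro arccos_le_arccos) auto
  then show ?thesis
    using assms \<open>r \<le> pi\<close> by (simp add: arccos_cos)
qed
text \<open>A knot \<open>(z, r)\<close> encodes the abscissa \<open>z / D\<close> and the upper bound \<open>r / Q\<close> of \<open>arccos (- z / D)\<close>. The last knot
  \<open>z = D\<close> needs \<open>\<pi> \<le> r / Q\<close>, which \<open>3217 / 1024 = 3.1416\<dots>\<close> ensures.\<close>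
definition knot_check :: "int \<Rightarrow> int \<Rightarrow> int \<times> int \<Rightarrow> bool" where
  "knot_check D Q = (\<lambda>(z, r). - D \<le> z \<and> z \<le> D \<and>
     (z = D \<and> 3217 * Q \<le> 1024 * r \<or>
      0 \<le> r \<and> 50 * r \<le> 157 * Q \<and> cos_upper (of_int r / of_int Q) \<le> - (of_int z / of_int D)))"

lemma arccos_le_if_knot_check:
  assumes "knot_check D Q (z, r)" "0 < D" "0 < Q"
  shows "arccos (- (of_int z / of_int D)) \<le> of_int r / of_int Q"
proof (cases "z = D \<and> 3217 * Q \<le> 1024 * r")
  case True
  then have "real_of_int (3217 * Q) \<le> of_int (1024 * r)"
    by (simp only: of_int_le_iff)
  then have "(3217 / 1024 :: real) \<le> of_int r / of_int Q"
    using assms by (simp add: field_simps)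
  moreover have "pi \<le> 3217 / 1024"
    using pi_approx by simp
  ultimately have "pi \<le> of_int r / of_int Q"
    by linarith
  then show ?thesis
    using True assms by simp
next
  case False
  then have *: "- D \<le> z" "0 \<le> r" "50 * r \<le> 157 * Q"
    "cos_upper (of_int r / of_int Q) \<le> - (of_int z / of_int D)"
    using assms by (auto simp: knot_check_def)
  have "real_of_int (50 * r) \<le> of_int (157 * Q)"
    using * by (simp only: of_int_le_iff)
  then have "of_int r / of_int Q \<le> (3.14 :: real)"
    using assms by (simp add: field_simps)
  moreover have "- real_of_int D \<le> of_int z"
    using * by linarith
  ultimately show ?thesis
    using * assms by (intro arccos_le) (auto simp: field_simps)
qed

text \<open>The inequality \<open>A p(z) \<ge> B (chord of r\<^sup>2)\<close> on \<open>[z\<^sub>0, z\<^sub>1]\<close>, multiplied by \<open>z\<^sub>1 - z\<^sub>0\<close> and written in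
  \<open>h = z - z\<^sub>0\<close>.\<close>
definition chord_check :: "int list \<Rightarrow> int \<Rightarrow> int \<Rightarrow> int \<times> int \<Rightarrow> int \<times> int \<Rightarrow> bool" where
  "chord_check p A B = (\<lambda>(z0, r0) (z1, r1). z0 < z1 \<and>
     0 \<le> lower_bound (z1 - z0)
       (add_poly (smult_poly (A * (z1 - z0)) (shift_poly z0 p))
          [- B * r0 * r0 * (z1 - z0), - B * (r1 * r1 - r0 * r0)]))"

fun chords_check :: "int list \<Rightarrow> int \<Rightarrow> int \<Rightarrow> (int \<times> int) list \<Rightarrow> bool" where
  "chords_check p A B (a # b # ks) \<longleftrightarrow> chord_check p A B a b \<and> chords_check p A B (b # ks)"
| "chords_check p A B _ \<longleftrightarrow> True"

text \<open>The chord dominates the squared arccosine; once \<open>Q^2\<close> and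
  \<open>z1 - z0\<close> are cleared, the nonnegativity of \<open>G\<close> says that
  \<open>A\<close> times the polynomial dominates \<open>B\<close> times the chord.\<close>

lemma chord_check_sound:
  assumes check: "chord_check p A B (z0, r0) (z1, r1)"
    and "0 < D" "0 < Q" "0 \<le> B"
    and knots: "knot_check D Q (z0, r0)" "knot_check D Q (z1, r1)"
    and c: "of_int z0 \<le> of_int D * c" "of_int D * c \<le> of_int z1"
  shows "of_int B * (of_int Q * arccos (- c))\<^sup>2 \<le> of_int A * horner p (of_int D * c)"
proof -
  define h where "h = of_int D * c - of_int z0"
  define S where "S = (arccos (- c))\<^sup>2"
  define G where "G = add_poly (smult_poly (A * (z1 - z0)) (shift_poly z0 p))
    [- B * r0 * r0 * (z1 - z0), - B * (r1 * r1 - r0 * r0)]"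
  have z: "real_of_int z0 < of_int z1" "- real_of_int D \<le> of_int z0" "real_of_int z1 \<le> of_int D"
    "real_of_int D > 0" "real_of_int Q > 0" "real_of_int B \<ge> 0"
    using check assms by (auto simp: chord_check_def knot_check_def simp flip: of_int_minus)
  have "S \<le> (of_int r0 / of_int Q)\<^sup>2 + ((of_int r1 / of_int Q)\<^sup>2 - (of_int r0 / of_int Q)\<^sup>2) *
      (c - of_int z0 / of_int D) / (of_int z1 / of_int D - of_int z0 / of_int D)"
    unfolding S_def using z c knots assms
    by (intro arccos_square_le_chord arccos_le_if_knot_check) (auto simp: field_simps)
  also have "\<dots> = ((of_int r0)\<^sup>2 + ((of_int r1)\<^sup>2 - (of_int r0)\<^sup>2) * (h / (of_int z1 - of_int z0))) / (of_int Q)\<^sup>2"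
  proof -
    have "(c - of_int z0 / of_int D) / (of_int z1 / of_int D - of_int z0 / of_int D) = h / (of_int z1 - of_int z0)"
      using z by (simp add: h_def field_simps)
    then show ?thesis
      by (simp only: times_divide_eq_right [symmetric]) (simp add: power_divide add_divide_distrib diff_divide_distrib algebra_simps)
  qed
  finally have "(of_int Q)\<^sup>2 * S \<le> (of_int r0)\<^sup>2 + ((of_int r1)\<^sup>2 - (of_int r0)\<^sup>2) * (h / (of_int z1 - of_int z0))"
    using z by (simp add: pos_le_divide_eq mult.commute)
  then have "(of_int z1 - of_int z0) * ((of_int Q)\<^sup>2 * S) \<le>
      (of_int z1 - of_int z0) * ((of_int r0)\<^sup>2 + ((of_int r1)\<^sup>2 - (of_int r0)\<^sup>2) * (h / (of_int z1 - of_int z0)))"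
    using z by (intro mult_left_mono) auto
  also have "\<dots> = (of_int r0)\<^sup>2 * (of_int z1 - of_int z0) + ((of_int r1)\<^sup>2 - (of_int r0)\<^sup>2) * h"
    using z by (simp add: field_simps)
  finally have "of_int B * ((of_int z1 - of_int z0) * ((of_int Q)\<^sup>2 * S)) \<le>
      of_int B * ((of_int r0)\<^sup>2 * (of_int z1 - of_int z0) + ((of_int r1)\<^sup>2 - (of_int r0)\<^sup>2) * h)"
    using z by (intro mult_left_mono) auto
  moreover have "0 \<le> horner G h"
  proof -
    have "of_int (lower_bound (z1 - z0) G) \<le> horner G h"
      using c by (intro lower_bound_le_horner) (auto simp: h_def)
    moreover have "0 \<le> lower_bound (z1 - z0) G"
      using check by (simp add: chord_check_def G_def)
    ultimately show ?thesis
      by (meson of_int_0_le_iff order_trans)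
  qed
  then have "of_int B * ((of_int r0)\<^sup>2 * (of_int z1 - of_int z0) + ((of_int r1)\<^sup>2 - (of_int r0)\<^sup>2) * h) \<le>
     (of_int z1 - of_int z0) * (of_int A * horner p (of_int D * c))"
    by (simp add: G_def horner_add_poly horner_smult_poly horner_shift_poly h_def power2_eq_square algebra_simps)
  ultimately have "(of_int z1 - of_int z0) * (of_int B * ((of_int Q)\<^sup>2 * S)) \<le>
     (of_int z1 - of_int z0) * (of_int A * horner p (of_int D * c))"
    by (simp add: mult.left_commute)
  then show ?thesis
    using z by (simp add: S_def power_mult_distrib)
qed

lemma chords_check_sound:
  assumes "chords_check p A B ks" "ks \<noteq> []" "list_all (knot_check D Q) ks" "0 < D" "0 < Q" "0 \<le> B"
    and "fst (last ks) = D" "of_int (fst (hd ks)) \<le> of_int D * c" "c \<le> 1" "tl ks \<noteq> []"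
  shows "of_int B * (of_int Q * arccos (- c))\<^sup>2 \<le> of_int A * horner p (of_int D * c)"
  using assms
proof (induction p A B ks rule: chords_check.induct)
  case (1 p A B a b ks)
  obtain z0 r0 z1 r1 where ab: "a = (z0, r0)" "b = (z1, r1)"
    by (metis surj_pair)
  show ?case
  proof (cases "of_int D * c \<le> of_int z1")
    case True
    then show ?thesis
      using 1 unfolding ab by (intro chord_check_sound) (auto simp: knot_check_def)
  next
    case False
    \<comment> \<open>Without a further knot \<open>z1\<close> would be the last abscissa
      \<open>D\<close>, and passing it contradicts \<open>c <= 1\<close>.\<close>
    have "ks \<noteq> []"
    proof
      assume "ks = []"
      then have "of_int D * c > real_of_int D * 1"
        using 1 False ab by simp
      then show False
        using 1 by (simp add: mult_le_cancel_left not_less [symmetric])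
    qed
    then show ?thesis
      using 1 False ab by auto
  qed
qed auto

section \<open>Many terms\<close>

lemma sin_ge_cubic:
  fixes x :: real
  assumes "0 < x"
  shows "x - x ^ 3 / 6 \<le> sin x"
proof -
  obtain t where "sin x = (\<Sum>m<3. sin_coeff m * x ^ m) + sin (t + 1/2 * real 3 * pi) / fact 3 * x ^ 3"
    using Maclaurin_sin_expansion3[of 3 x] assms by auto
  moreover have "- 1 / 6 * x ^ 3 \<le> sin (t + 1/2 * real 3 * pi) / fact 3 * x ^ 3"
    using assms by (intro mult_right_mono) (auto simp: fact_numeral)
  ultimately show ?thesis
    by (simp add: sin_coeff_def numeral_3_eq_3)
qed

lemma cos_ge_quadratic: "1 - x\<^sup>2 / 2 \<le> cos (x :: real)"
  using cos_taylor_error[of x 2] by (simp add: numeral_2_eq_2 abs_le_iff cos_coeff_def)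

lemma acoef_9: "acoef 9 = 12155 / 65536"
  by (simp add: eval_nat_numeral acoef_Suc)

text \<open>The left side decreases in \<open>m\<close>, because (a + 1)(a + 3) <= (a + 2)^2 for
  \<open>a = 2 * m\<close>. The constant is its value at 9 rounded up; 9 is the first omitted index
  when \<open>n = 8\<close>.\<close>

lemma acoef_square_le: "9 \<le> m \<Longrightarrow> (4 * real m + 2) * (acoef m)\<^sup>2 \<le> 1.3072"
proof (induction m rule: dec_induct)
  case base
  show ?case
    by (simp add: acoef_9 power2_eq_square)
next
  case (step m)
  define a where "a = 2 * real m"
  have "acoef (Suc m) = (a + 1) / (a + 2) * acoef m" "4 * real (Suc m) + 2 = 2 * (a + 3)"
    by (simp_all add: acoef_Suc a_def)
  then have "(4 * real (Suc m) + 2) * (acoef (Suc m))\<^sup>2 =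
    (2 * (a + 3)) * ((a + 1) / (a + 2))\<^sup>2 * (acoef m)\<^sup>2"
    by (simp only: power_mult_distrib mult.assoc)
  also have "\<dots> \<le> (2 * (a + 1)) * (acoef m)\<^sup>2"
  proof (rule mult_right_mono)
    have "(a + 3) * (a + 1) \<le> (a + 2)\<^sup>2"
      by (simp add: power2_eq_square algebra_simps)
    then have "2 * (a + 1) * ((a + 3) * (a + 1)) \<le> 2 * (a + 1) * (a + 2)\<^sup>2"
      by (intro mult_left_mono) (auto simp: a_def)
    moreover have "0 < (a + 2)\<^sup>2"
      by (simp add: a_def zero_less_power)
    ultimately have "2 * (a + 1) * ((a + 3) * (a + 1)) / (a + 2)\<^sup>2 \<le> 2 * (a + 1)"
      by (simp only: pos_divide_le_eq)
    then show "(2 * (a + 3)) * ((a + 1) / (a + 2))\<^sup>2 \<le> 2 * (a + 1)"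
      by (simp only: power_divide power2_eq_square times_divide_eq_right divide_divide_eq_left mult_ac)
  qed simp
  also have "\<dots> = (4 * real m + 2) * (acoef m)\<^sup>2"
    by (simp add: a_def algebra_simps)
  finally show ?case
    using step.IH by linarith
qed

text \<open>The condition on \<open>c\<close> yields \<open>acoef (Suc n) <= c * sqrt s\<close> with
  \<open>s = sin (2 * x)\<close>, so the tail is at most the fraction \<open>c * (1 + 2 / P)\<close>
  of the main term \<open>1 / (2 * sqrt s)\<close>.\<close>

lemma jacobi_sum_ge_if_phase_ge:
  assumes x: "0 < x" "x < pi / 2" and n: "8 \<le> n"
    and P: "0 < P" "P \<le> (4 * real n + 6) * sin (2 * x)"
    and c: "0 \<le> c" "1.3072 \<le> c\<^sup>2 * P"
  shows "(1 - c * (1 + 2 / P)) / (2 * sqrt (sin (2 * x))) \<le> jacobi_sum n x"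
proof -
  define s where "s = sin (2 * x)"
  have s: "0 < s"
    unfolding s_def using x by (intro sin_gt_zero) auto
  have "(4 * real n + 6) * (acoef (Suc n))\<^sup>2 \<le> 1.3072"
    using acoef_square_le[of "Suc n"] n by (simp add: algebra_simps)
  also have "\<dots> \<le> c\<^sup>2 * ((4 * real n + 6) * s)"
    using c(2) P by (smt (verit, best) mult_left_mono s_def zero_le_power2)
  finally have "(4 * real n + 6) * (acoef (Suc n))\<^sup>2 \<le> (4 * real n + 6) * (c * sqrt s)\<^sup>2"
    using s by (simp add: power_mult_distrib mult.left_commute)
  then have "(acoef (Suc n))\<^sup>2 \<le> (c * sqrt s)\<^sup>2"
    by (subst (asm) mult_le_cancel_left_pos) auto
  then have a: "acoef (Suc n) \<le> c * sqrt s"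
    by (rule power2_le_imp_le) (use c s in auto)
  have "(4 * real n + 8) * s = 2 * (2 * (real n + 2) * s)"
    by (simp add: algebra_simps)
  moreover have "1 / p = 2 / (2 * p)" for p :: real
    by simp
  ultimately have "1 / (2 * (real n + 2) * s) = 2 / ((4 * real n + 8) * s)"
    by metis
  also have "\<dots> \<le> 2 / P"
  proof (rule divide_left_mono)
    have "(4 * real n + 6) * s \<le> (4 * real n + 8) * s"
      using s by (intro mult_right_mono) auto
    then show "P \<le> (4 * real n + 8) * s"
      using P by (simp only: s_def)
    show "0 < (4 * real n + 8) * s * P"
      using P s by (intro mult_pos_pos) auto
  qed simp
  finally have "acoef (Suc n) * (1 + 1 / (2 * (real n + 2) * s)) / (2 * s) \<le> (c * sqrt s) * (1 + 2 / P) / (2 * s)"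
    using a c s P by (intro divide_right_mono mult_mono) auto
  also have "\<dots> = c * (1 + 2 / P) / (2 * sqrt s)"
  proof -
    have "c * q * k / (2 * (q * q)) = c * k / (2 * q)" if "0 < q" for q k :: real
      using that by simp
    from this[of "sqrt s" "1 + 2 / P"] s show ?thesis
      by simp
  qed
  finally have "1 / (2 * sqrt s) - c * (1 + 2 / P) / (2 * sqrt s) \<le> jacobi_sum n x"
    using jacobi_sum_tail_bound[OF x, of n] by (simp add: s_def)
  then show ?thesis
    by (simp add: s_def diff_divide_distrib)
qed

text \<open>The right-hand side of the theorem with \<open>0.123\<close> in place of the minimum.\<close>
definition parabola_bound :: "real \<Rightarrow> real" where
  "parabola_bound x = 0.123 * (pi - 2 * x)\<^sup>2 / (2 * cos x)"

text \<open>The numerator is largest at \<open>x1\<close> and the quadratic minorant of cosine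
  smallest at \<open>x2\<close>, so one rational inequality covers the whole interval.\<close>

lemma parabola_bound_le:
  assumes "0 \<le> x1" "x1 \<le> x" "x \<le> x2" "x2 \<le> 1"
    and "0.123 * (3.1416 - 2 * x1)\<^sup>2 \<le> 2 * (1 - x2\<^sup>2 / 2) * L"
  shows "parabola_bound x \<le> L"
proof -
  have pi: "3.14 \<le> pi" "pi \<le> 3.1416"
    using pi_approx by simp_all
  have "x2\<^sup>2 \<le> 1"
    using assms by (simp add: power_le_one)
  moreover have "x\<^sup>2 \<le> x2\<^sup>2"
    using assms by (intro power_mono) auto
  then have "1 - x2\<^sup>2 / 2 \<le> cos x"
    using cos_ge_quadratic[of x] by simp
  ultimately have c: "0 < 1 - x2\<^sup>2 / 2" "1 - x2\<^sup>2 / 2 \<le> cos x"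
    by simp_all
  have "0 \<le> 0.123 * (3.1416 - 2 * x1)\<^sup>2"
    by simp
  then have "0 \<le> L"
    using assms c by (smt (verit) mult_neg_pos mult_pos_neg)
  have "0.123 * (pi - 2 * x)\<^sup>2 \<le> 0.123 * (3.1416 - 2 * x1)\<^sup>2"
    using pi assms by (intro mult_left_mono power_mono) auto
  also have "\<dots> \<le> 2 * (1 - x2\<^sup>2 / 2) * L"
    by fact
  also have "\<dots> \<le> 2 * cos x * L"
    using c \<open>0 \<le> L\<close> by (intro mult_right_mono) auto
  finally show ?thesis
    using c by (simp add: parabola_bound_def field_simps)
qed

text \<open>A concave function on an interval is at least the smaller of its end values; the
  identity in the proof is linear interpolation with explicit remainder.\<close>

lemma concave_quartic_ge:
  fixes A B w w1 w2 L :: real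
  defines "p \<equiv> \<lambda>w. w / 2 - A * w\<^sup>2 - B * w ^ 4"
  assumes "0 \<le> A" "0 \<le> B" "0 \<le> w1" "w1 \<le> w" "w \<le> w2" "L \<le> p w1" "L \<le> p w2" "w1 < w2"
  shows "L \<le> p w"
proof -
  have "(w2 - w1) * p w = (w2 - w) * p w1 + (w - w1) * p w2 + (w - w1) * (w2 - w) * (w2 - w1) *
      (A + B * (w\<^sup>2 + w1\<^sup>2 + w2\<^sup>2 + w * w1 + w * w2 + w1 * w2))"
    unfolding p_def by (simp add: power2_eq_square power4_eq_xxxx field_simps)
  also have "\<dots> \<ge> (w2 - w) * L + (w - w1) * L + 0"
    using assms by (intro add_mono mult_left_mono) auto
  finally have "(w2 - w1) * L \<le> (w2 - w1) * p w"
    by (simp add: algebra_simps)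
  then show ?thesis
    using assms by simp
qed

text \<open>In \<open>w = 1 / sqrt (sin (2 * x))\<close> the tail bound is a concave quartic. Its
  coefficients are \<open>0.1855 / 2\<close> and \<open>0.1855 / 40\<close> rounded up, with
  \<open>0.1855\<close> above \<open>acoef 9\<close>; \<open>1.973\<close> exceeds
  \<open>1 / sqrt 0.25707\<close>, and \<open>0.555\<close> is below the quartic at
  \<open>1.973\<close>.\<close>

lemma jacobi_sum_ge_quartic:
  assumes x: "0 < x" "x < pi / 2" and n: "8 \<le> n" and s: "0.25707 \<le> sin (2 * x)"
    and w1: "sin (2 * x) * w1\<^sup>2 \<le> 1" "0 \<le> w1" "w1 < 1.973"
    and L: "L \<le> w1 / 2 - 0.09275 * w1\<^sup>2 - 0.00464 * w1 ^ 4" "L \<le> 0.555"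
  shows "L \<le> jacobi_sum n x"
proof -
  define s where "s = sin (2 * x)"
  define w where "w = 1 / sqrt s"
  have s0: "0.25707 \<le> s"
    using s by (simp add: s_def)
  have w2: "w\<^sup>2 = 1 / s"
    using s0 by (simp add: w_def power_divide)
  have a: "acoef (Suc n) \<le> 0.1855"
    using decseqD[OF acoef_antimono, of 9 "Suc n"] n by (simp add: acoef_9)
  have "1 / (2 * (real n + 2) * s) \<le> 1 / (20 * s)"
    using n s0 by (intro divide_left_mono) auto
  then have "acoef (Suc n) * (1 + 1 / (2 * (real n + 2) * s)) / (2 * s) \<le> 0.1855 * (1 + 1 / (20 * s)) / (2 * s)"
    using a s0 by (intro divide_right_mono mult_mono) auto
  also have "\<dots> = 0.09275 * w\<^sup>2 + 0.0046375 * (w\<^sup>2)\<^sup>2"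
    using s0 unfolding w2 by (simp add: field_simps power2_eq_square)
  also have "\<dots> \<le> 0.09275 * w\<^sup>2 + 0.00464 * w ^ 4"
    by (simp flip: power_mult)
  finally have "w / 2 - 0.09275 * w\<^sup>2 - 0.00464 * w ^ 4 \<le> jacobi_sum n x"
    using jacobi_sum_tail_bound[OF x, of n] by (simp add: w_def flip: s_def)
  moreover have "L \<le> w / 2 - 0.09275 * w\<^sup>2 - 0.00464 * w ^ 4"
  proof (rule concave_quartic_ge)
    have "w1\<^sup>2 \<le> w\<^sup>2"
      unfolding w2 using w1 s0 by (simp add: s_def field_simps)
    then show "w1 \<le> w"
      by (rule power2_le_imp_le) (use s0 in \<open>auto simp: w_def\<close>)
    have "w\<^sup>2 \<le> 1.973\<^sup>2"
      unfolding w2 using s0 by (simp add: field_simps power2_eq_square)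
    then show "w \<le> 1.973"
      by (rule power2_le_imp_le) auto
    show "L \<le> 1.973 / 2 - 0.09275 * 1.973\<^sup>2 - 0.00464 * 1.973 ^ 4"
      using L by (simp add: power2_eq_square power4_eq_xxxx)
  qed (use w1 L in auto)
  ultimately show ?thesis
    by linarith
qed

lemma parabola_bound_le_jacobi_sum_piece:
  assumes x: "0 < x" "x < pi / 2" and n: "8 \<le> n" and s: "0.25707 \<le> sin (2 * x)"
    and z: "0 \<le> x1" "x1 \<le> x" "x \<le> x2" "x2 \<le> 1"
    and t: "sin (2 * x) \<le> t" "t * w1\<^sup>2 \<le> 1"
    and w1: "0 \<le> w1" "w1 < 1.973"
    and L: "L \<le> w1 / 2 - 0.09275 * w1\<^sup>2 - 0.00464 * w1 ^ 4" "L \<le> 0.555"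
      "0.123 * (3.1416 - 2 * x1)\<^sup>2 \<le> 2 * (1 - x2\<^sup>2 / 2) * L"
  shows "parabola_bound x \<le> jacobi_sum n x"
proof -
  have "sin (2 * x) * w1\<^sup>2 \<le> t * w1\<^sup>2"
    using t by (intro mult_right_mono) auto
  then show ?thesis
    using parabola_bound_le[OF z L(3)] jacobi_sum_ge_quartic[OF x n s _ w1 L(1,2)] t by linarith
qed

lemma parabola_bound_le_jacobi_sum_moderate:
  assumes x: "0.13 \<le> x" "x \<le> pi / 4" and n: "8 \<le> n"
  shows "parabola_bound x \<le> jacobi_sum n x"
proof -
  have pi: "3.14 \<le> pi" "pi \<le> 3.1416"
    using pi_approx by simp_all
  have x': "0 < x" "x < pi / 2"
    using x pi by auto
  have sx: "sin (2 * x) \<le> 2 * x" "sin (2 * x) \<le> 1"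
    using x sin_x_le_x[of "2 * x"] by simp_all
  have "0.25707 \<le> (0.26 :: real) - 0.26 ^ 3 / 6"
    by (simp add: power3_eq_cube)
  also have "\<dots> \<le> sin 0.26"
    by (rule sin_ge_cubic) simp
  also have "\<dots> \<le> sin (2 * x)"
    using x pi by (intro sin_monotone_2pi_le) auto
  finally have s: "0.25707 \<le> sin (2 * x)" .
  note piece = parabola_bound_le_jacobi_sum_piece[OF x' n s]
  \<comment> \<open>In each piece \<open>t\<close> bounds the sine by \<open>2 * x2\<close> or 1,
    \<open>w1\<close> is \<open>1 / sqrt t\<close> rounded down where needed, and \<open>L\<close>
    separates the two sides. In the last piece \<open>0.7854\<close> exceeds pi/4.\<close>
  consider "x \<le> 0.19" | "0.19 \<le> x" "x \<le> 0.25" | "0.25 \<le> x" "x \<le> 0.325" | "0.325 \<le> x" "x \<le> 0.4"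
    | "0.4 \<le> x" "x \<le> 0.525" | "0.525 \<le> x"
    by linarith
  then show ?thesis
  proof cases
    case 1
    then show ?thesis
      using x sx by (intro piece[of "0.13" "0.19" "2 * 0.19" "1.62" "0.53"])
        (auto simp: power2_eq_square power4_eq_xxxx)
  next
    case 2
    then show ?thesis
      using x sx by (intro piece[of "0.19" "0.25" "2 * 0.25" "1.414" "0.5"])
        (auto simp: power2_eq_square power4_eq_xxxx)
  next
    case 3
    then show ?thesis
      using x sx by (intro piece[of "0.25" "0.325" "2 * 0.325" "1.24" "0.46"])
        (auto simp: power2_eq_square power4_eq_xxxx)
  next
    case 4
    then show ?thesis
      using x sx by (intro piece[of "0.325" "0.4" "2 * 0.4" "1.118" "0.43"])
        (auto simp: power2_eq_square power4_eq_xxxx)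
  next
    case 5
    then show ?thesis
      using x sx by (intro piece[of "0.4" "0.525" "1" "1" "0.4"])
        (auto simp: power2_eq_square power4_eq_xxxx)
  next
    case 6
    then show ?thesis
      using x sx pi by (intro piece[of "0.525" "0.7854" "1" "1" "0.4"])
        (auto simp: power2_eq_square power4_eq_xxxx)
  qed
qed

text \<open>For \<open>v = sqrt (2 * x)\<close> the sum is at least a constant over
  \<open>v\<close>, so it remains to bound (pi - v^2)^2 v.\<close>

lemma parabola_bound_le_jacobi_sum_small:
  assumes x: "0 < x" "x \<le> 0.13" and n: "8 \<le> n" and phase: "3 * pi / 2 \<le> (4 * real n + 5) * x"
  shows "parabola_bound x \<le> jacobi_sum n x"
proof -
  have pi: "3.14 \<le> pi" "pi \<le> 3.1416"
    using pi_approx by simp_all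
  define v where "v = sqrt (2 * x)"
  have v: "0 < v" "v\<^sup>2 = 2 * x"
    using x by (simp_all add: v_def)
  have v_le: "v \<le> 0.51"
    by (rule power2_le_imp_le) (use x v in \<open>simp_all add: v(2) power2_eq_square\<close>)
  \<comment> \<open>The factor is \<open>1 - 0.26^2 / 6\<close> rounded down.\<close>
  have s: "0.98873 * (2 * x) \<le> sin (2 * x)"
  proof -
    have "x\<^sup>2 \<le> 0.13\<^sup>2"
      using x by (intro power_mono) auto
    then have "x * x\<^sup>2 \<le> x * 0.13\<^sup>2"
      using x by (intro mult_left_mono) auto
    then have "0.98873 * (2 * x) \<le> 2 * x - (2 * x) ^ 3 / 6"
      using x by (simp add: power2_eq_square power3_eq_cube)
    then show ?thesis
      using sin_ge_cubic[of "2 * x"] x by simp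
  qed
  define X where "X = (4 * real n + 5) * x"
  \<comment> \<open>The phase condition gives \<open>3 * pi * 0.98873\<close>, which exceeds
    \<open>9.31\<close>. Below, \<open>0.3748\<close> is sqrt (1.3072 / 9.31) rounded up, and
    \<open>0.27234\<close> is half of the resulting numerator rounded down.\<close>
  have "9.31 \<le> 0.98873 * (2 * X)"
    using phase pi by (simp flip: X_def)
  also have "\<dots> \<le> (4 * real n + 6) * (0.98873 * (2 * x))"
    using x by (simp add: X_def algebra_simps)
  also have "\<dots> \<le> (4 * real n + 6) * sin (2 * x)"
    using s by (intro mult_left_mono) auto
  finally have "9.31 \<le> (4 * real n + 6) * sin (2 * x)" .
  then have "(1 - 0.3748 * (1 + 2 / 9.31)) / (2 * sqrt (sin (2 * x))) \<le> jacobi_sum n x"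
    by (rule jacobi_sum_ge_if_phase_ge[OF _ _ n, rotated 3]) (use x pi in \<open>simp_all add: power2_eq_square\<close>)
  moreover have "0.27234 / v \<le> (1 - 0.3748 * (1 + 2 / 9.31)) / (2 * sqrt (sin (2 * x)))"
  proof -
    have "0 < sin (2 * x)"
      using s x by simp
    moreover have "sqrt (sin (2 * x)) \<le> v"
      unfolding v_def using sin_x_le_x[of "2 * x"] x by simp
    ultimately have "0.54468 / (2 * v) \<le> 0.54468 / (2 * sqrt (sin (2 * x)))"
      using v by (intro divide_left_mono) auto
    also have "\<dots> \<le> (1 - 0.3748 * (1 + 2 / 9.31)) / (2 * sqrt (sin (2 * x)))"
      using \<open>0 < sin (2 * x)\<close> by (intro divide_right_mono) auto
    finally show ?thesis
      by simp
  qed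
  moreover have "parabola_bound x \<le> 0.27234 / v"
  proof -
    \<comment> \<open>One factor falls and the other grows in \<open>v\<close>; they are bounded at
      opposite ends of three subintervals of \<open>[0, 0.51]\<close>.\<close>
    have "(3.1416 - v\<^sup>2)\<^sup>2 * v \<le> 4.39"
    proof -
      have *: "(3.1416 - v\<^sup>2)\<^sup>2 * v \<le> (3.1416 - a\<^sup>2)\<^sup>2 * b" if "0 \<le> a" "a \<le> v" "v \<le> b" for a b
      proof (intro mult_mono power_mono)
        have "v\<^sup>2 \<le> 0.51\<^sup>2"
          using v_le v by (intro power_mono) auto
        then show "0 \<le> 3.1416 - v\<^sup>2"
          by (simp add: power2_eq_square)
        show "3.1416 - v\<^sup>2 \<le> 3.1416 - a\<^sup>2"
          using that power_mono[of a v 2] by simp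
      qed (use that v in auto)
      consider "v \<le> 0.44" | "0.44 \<le> v" "v \<le> 0.48" | "0.48 \<le> v"
        by linarith
      then show ?thesis
      proof cases
        case 1
        then show ?thesis
          using *[of 0 "0.44"] v by (simp add: power2_eq_square)
      next
        case 2
        then show ?thesis
          using *[of "0.44" "0.48"] by (simp add: power2_eq_square)
      next
        case 3
        then show ?thesis
          using *[of "0.48" "0.51"] v_le by (simp add: power2_eq_square)
      qed
    qed
    then have "0.123 * ((3.1416 - 2 * x)\<^sup>2 * v) \<le> 0.123 * 4.39"
      unfolding v(2) by (intro mult_left_mono) auto
    also have "\<dots> \<le> 2 * (1 - 0.13\<^sup>2 / 2) * 0.27234"
      by (simp add: power2_eq_square)
    finally have "0.123 * (3.1416 - 2 * x)\<^sup>2 \<le> 2 * (1 - 0.13\<^sup>2 / 2) * (0.27234 / v)"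
      using v by (simp add: field_simps)
    then show ?thesis
      using x by (intro parabola_bound_le) auto
  qed
  ultimately show ?thesis
    by linarith
qed

text \<open>Near pi/2 the right-hand side vanishes linearly in \<open>u\<close>, while past the
  first trough the sum exceeds a fixed constant; \<open>0.2327\<close> separates them.\<close>

lemma parabola_bound_le_jacobi_sum_reflected:
  assumes u: "0 < u" "u < pi / 4" and n: "8 \<le> n" and phase: "2 * pi \<le> (4 * real n + 5) * u"
  shows "parabola_bound (pi / 2 - u) \<le> jacobi_sum n (pi / 2 - u)"
proof -
  have pi: "3.14 \<le> pi" "pi \<le> 3.1416"
    using pi_approx by simp_all
  have sin_eq: "sin (2 * (pi / 2 - u)) = sin (2 * u)"
    by (simp add: right_diff_distrib)
  have u2: "u\<^sup>2 \<le> 0.7854\<^sup>2"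
    using u pi by (intro power_mono) auto
  \<comment> \<open>The factor is \<open>1 - (2 * 0.7854)^2 / 6\<close> rounded down. Then
    \<open>7.39\<close> lies below \<open>4 * pi * 0.58876\<close>, and \<open>0.4206\<close> is
    sqrt (1.3072 / 7.39) rounded up.\<close>
  have s: "0.58876 * (2 * u) \<le> sin (2 * u)"
  proof -
    have "u * u\<^sup>2 \<le> u * 0.7854\<^sup>2"
      using u u2 by (intro mult_left_mono) auto
    then have "0.58876 * (2 * u) \<le> 2 * u - (2 * u) ^ 3 / 6"
      using u by (simp add: power2_eq_square power3_eq_cube)
    then show ?thesis
      using sin_ge_cubic[of "2 * u"] u by simp
  qed
  define X where "X = (4 * real n + 5) * u"
  have "7.39 \<le> 0.58876 * (2 * X)"
    using phase pi by (simp flip: X_def)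
  also have "\<dots> \<le> (4 * real n + 6) * (0.58876 * (2 * u))"
    using u by (simp add: X_def algebra_simps)
  also have "\<dots> \<le> (4 * real n + 6) * sin (2 * (pi / 2 - u))"
    unfolding sin_eq using s by (intro mult_left_mono) auto
  finally have "7.39 \<le> (4 * real n + 6) * sin (2 * (pi / 2 - u))" .
  then have "(1 - 0.4206 * (1 + 2 / 7.39)) / (2 * sqrt (sin (2 * (pi / 2 - u)))) \<le> jacobi_sum n (pi / 2 - u)"
    by (rule jacobi_sum_ge_if_phase_ge[OF _ _ n, rotated 3]) (use u pi in \<open>simp_all add: power2_eq_square\<close>)
  moreover have "0.2327 \<le> (1 - 0.4206 * (1 + 2 / 7.39)) / (2 * sqrt (sin (2 * (pi / 2 - u))))"
  proof -
    have "0 < sin (2 * u)"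
      using u s by simp
    then have "0.4654 / (2 * 1) \<le> 0.4654 / (2 * sqrt (sin (2 * u)))"
      by (intro divide_left_mono) auto
    also have "\<dots> \<le> (1 - 0.4206 * (1 + 2 / 7.39)) / (2 * sqrt (sin (2 * u)))"
      using \<open>0 < sin (2 * u)\<close> by (intro divide_right_mono) auto
    finally show ?thesis
      unfolding sin_eq by simp
  qed
  moreover have "parabola_bound (pi / 2 - u) \<le> 0.2327"
  proof -
    have "u * u\<^sup>2 \<le> u * 0.7854\<^sup>2"
      using u u2 by (intro mult_left_mono) auto
    then have "0.897 * u \<le> u - u ^ 3 / 6"
      using u by (simp add: power2_eq_square power3_eq_cube)
    then have sin_u: "0.897 * u \<le> sin u"
      using sin_ge_cubic[of u] u by simp
    have "0.123 * (2 * u)\<^sup>2 = u * (0.492 * u)"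
      by (simp add: power2_eq_square)
    also have "\<dots> \<le> u * (2 * 0.897 * 0.2327)"
      using u pi by (intro mult_left_mono) auto
    also have "\<dots> \<le> 2 * sin u * 0.2327"
      using sin_u by simp
    finally have "0.123 * (2 * u)\<^sup>2 / (2 * sin u) \<le> 0.2327"
      using sin_u u by (subst pos_divide_le_eq) auto
    moreover have "cos (pi / 2 - u) = sin u" "pi - 2 * (pi / 2 - u) = 2 * u"
      by (simp_all add: cos_diff)
    ultimately show ?thesis
      unfolding parabola_bound_def by simp
  qed
  ultimately show ?thesis
    by linarith
qed

section \<open>Reduction to phases beyond the first trough\<close>

lemma jacobi_sum_ge_first_if_nonneg:
  assumes "\<And>j. j \<le> n \<Longrightarrow> 0 \<le> cos (real (4 * j + 1) * x)"
  shows "jacobi_sum 0 x \<le> jacobi_sum n x"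
proof -
  have "(\<Sum>j\<in>{0}. acoef j * cos (real (4 * j + 1) * x)) \<le> (\<Sum>j\<le>n. acoef j * cos (real (4 * j + 1) * x))"
    using assms acoef_pos by (intro sum_mono2) (auto simp: less_imp_le)
  then show ?thesis
    by (simp add: jacobi_sum_def)
qed

lemma jacobi_sum_antimono_if_nonpos:
  assumes "n \<le> n'" "\<And>j. n < j \<Longrightarrow> j \<le> n' \<Longrightarrow> cos (real (4 * j + 1) * x) \<le> 0"
  shows "jacobi_sum n' x \<le> jacobi_sum n x"
  using assms
proof (induction n' rule: dec_induct)
  case (step k)
  have "jacobi_sum k x \<le> jacobi_sum n x"
    using step by auto
  moreover have "acoef (Suc k) * cos (real (4 * Suc k + 1) * x) \<le> 0"
    using step.prems[of "Suc k"] step.hyps acoef_pos[of "Suc k"] by (simp add: mult_nonneg_nonpos less_imp_le)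
  ultimately show ?case
    by (simp add: jacobi_sum_def)
qed simp

text \<open>If \<open>(4n+1)u\<close> lies on the descending stretch \<open>[a, b]\<close>, adding further terms until the phase leaves it only
  decreases the sum. Hence only \<open>n\<close> with \<open>(4n+5)u \<ge> b\<close> need an estimate.\<close>
lemma le_jacobi_sum_by_troughs:
  assumes "0 < u" and n: "8 \<le> n" and "a \<le> b"
    and start: "\<And>t. 0 \<le> t \<Longrightarrow> t \<le> a \<Longrightarrow> 0 \<le> f t"
    and descent: "\<And>t. a \<le> t \<Longrightarrow> t \<le> b \<Longrightarrow> f t \<le> 0"
    and f: "\<And>j. cos (real (4 * j + 1) * x) = f (real (4 * j + 1) * u)"
    and first: "r \<le> jacobi_sum 0 x"
    and trough: "\<And>n. 8 \<le> n \<Longrightarrow> b \<le> (4 * real n + 5) * u \<Longrightarrow> r \<le> jacobi_sum n x"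
  shows "r \<le> jacobi_sum n x"
proof (cases "real (4 * n + 1) * u \<le> a")
  case True
  have "0 \<le> cos (real (4 * j + 1) * x)" if "j \<le> n" for j
  proof -
    have "real (4 * j + 1) * u \<le> real (4 * n + 1) * u"
      using that \<open>0 < u\<close> by (intro mult_right_mono) auto
    moreover have "0 \<le> real (4 * j + 1) * u"
      using \<open>0 < u\<close> by simp
    ultimately show ?thesis
      unfolding f using True by (intro start) linarith+
  qed
  then show ?thesis
    using jacobi_sum_ge_first_if_nonneg first by (meson order_trans)
next
  case False
  obtain N where "b / u < real N"
    using reals_Archimedean2 by blast
  then have "b < real N * u"
    using \<open>0 < u\<close> by (simp add: pos_divide_less_eq)
  moreover have "real N * u \<le> (4 * real N + 5) * u"
    using \<open>0 < u\<close> by (intro mult_right_mono) auto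
  ultimately have "b \<le> (4 * real N + 5) * u"
    by linarith
  moreover have "(4 * real N + 5) * u \<le> (4 * real (max n N) + 5) * u"
    using \<open>0 < u\<close> by (intro mult_right_mono) auto
  ultimately have "n \<le> max n N \<and> b \<le> (4 * real (max n N) + 5) * u"
    by auto
  \<comment> \<open>The least such index is taken so that the phases of all terms added after
    \<open>n\<close> stay at most \<open>b\<close>.\<close>
  then obtain n' where n': "n \<le> n'" "b \<le> (4 * real n' + 5) * u"
    and least: "\<And>k. k < n' \<Longrightarrow> \<not> (n \<le> k \<and> b \<le> (4 * real k + 5) * u)"
    using exists_least_iff[of "\<lambda>k. n \<le> k \<and> b \<le> (4 * real k + 5) * u"] by blast
  have "jacobi_sum n' x \<le> jacobi_sum n x"
  proof (rule jacobi_sum_antimono_if_nonpos[OF n'(1)])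
    fix j
    assume j: "n < j" "j \<le> n'"
    have "real (4 * n + 1) * u \<le> real (4 * j + 1) * u"
      using j \<open>0 < u\<close> by (intro mult_right_mono) auto
    moreover have "real (4 * j + 1) * u \<le> b"
    proof -
      \<comment> \<open>The phase factor \<open>4 * j + 1\<close> equals \<open>4 * i + 5\<close>,
        so minimality at \<open>i\<close> bounds the phase of term \<open>j\<close>.\<close>
      obtain i where i: "j = Suc i"
        using j by (cases j) auto
      then have "\<not> b \<le> (4 * real i + 5) * u"
        using least[of i] j by auto
      then show ?thesis
        by (simp add: i algebra_simps)
    qed
    ultimately show "cos (real (4 * j + 1) * x) \<le> 0"
      unfolding f using False by (intro descent) linarith+
  qed
  moreover have "r \<le> jacobi_sum n' x"
    using n n' by (intro trough) auto
  ultimately show ?thesis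
    by linarith
qed

text \<open>Phases are counted from the nearer end of the interval: cosine descends below zero on
  [pi/2, 3 pi/2], and after reflection sine does so on [pi, 2 pi]. Initial stretches without a
  negative term reduce to \<open>n = 0\<close>.\<close>

lemma parabola_bound_le_jacobi_sum_large:
  assumes n: "8 \<le> n" and x: "0 < x" "x < pi / 2" and first: "parabola_bound x \<le> jacobi_sum 0 x"
  shows "parabola_bound x \<le> jacobi_sum n x"
proof (cases "x \<le> pi / 4")
  case True
  show ?thesis
  proof (rule le_jacobi_sum_by_troughs[where u = x and a = "pi / 2" and b = "3 * pi / 2" and f = cos])
    show "0 \<le> cos t" if "0 \<le> t" "t \<le> pi / 2" for t
      using that by (intro cos_ge_zero) auto
    show "cos t \<le> 0" if "pi / 2 \<le> t" "t \<le> 3 * pi / 2" for t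
      using that cos_ge_zero[of "t - pi"] by simp
    show "parabola_bound x \<le> jacobi_sum n x" if "8 \<le> n" "3 * pi / 2 \<le> (4 * real n + 5) * x" for n
      using parabola_bound_le_jacobi_sum_moderate[of x n] parabola_bound_le_jacobi_sum_small[of x n] that x True by linarith
  qed (use x n first in auto)
next
  case False
  define u where "u = pi / 2 - x"
  have x_eq: "x = pi / 2 - u" and u: "0 < u" "u < pi / 4"
    using False x by (auto simp: u_def)
  show ?thesis
  proof (rule le_jacobi_sum_by_troughs[where u = u and a = pi and b = "2 * pi" and f = sin])
    show "sin t \<le> 0" if "pi \<le> t" "t \<le> 2 * pi" for t
      using that sin_ge_zero[of "t - pi"] by simp
    show "cos (real (4 * j + 1) * x) = sin (real (4 * j + 1) * u)" for j
    proof -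
      have "real (4 * j + 1) * x = pi / 2 - real (4 * j + 1) * u + 2 * real j * pi"
        unfolding x_eq by (simp add: algebra_simps)
      then have "cos (real (4 * j + 1) * x) = cos (pi / 2 - real (4 * j + 1) * u + 2 * real j * pi)"
        by simp
      also have "\<dots> = sin (real (4 * j + 1) * u)"
        unfolding cos_add[of _ "2 * real j * pi"] cos_2npi sin_2npi by (simp add: cos_diff)
      finally show ?thesis .
    qed
    show "parabola_bound x \<le> jacobi_sum n x" if "8 \<le> n" "2 * pi \<le> (4 * real n + 5) * u" for n
      unfolding x_eq using that u by (intro parabola_bound_le_jacobi_sum_reflected)
  qed (use u n first in \<open>auto intro: sin_ge_zero\<close>)
qed

section \<open>Few terms\<close>

lemma acoef_eq_b_coeff: "b_coeff (2 * k) = acoef k" "b_coeff (2 * k + 1) = acoef k"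
proof -
  have "1 / 4 ^ k * real ((2 * k) choose k) = acoef k"
  proof (induction k)
    case (Suc k)
    have "real (Suc k) * real ((2 * Suc k) choose Suc k) = 2 * (2 * real k + 1) * real ((2 * k) choose k)"
    proof -
      have "Suc k * (Suc (Suc (2 * k)) choose Suc k) = Suc (Suc (2 * k)) * (Suc (2 * k) choose k)"
        using Suc_times_binomial[of k "Suc (2 * k)"] by simp
      moreover have "Suc k * (Suc (2 * k) choose k) = Suc (2 * k) * (2 * k choose k)"
        using Suc_times_binomial[of k "2 * k"] binomial_symmetric[of k "Suc (2 * k)"] by simp
      ultimately have "Suc k * (Suc k * (Suc (Suc (2 * k)) choose Suc k)) = Suc k * (2 * (Suc (2 * k) * (2 * k choose k)))"
        by (simp add: algebra_simps)
      then have "Suc k * (Suc (Suc (2 * k)) choose Suc k) = 2 * (Suc (2 * k) * (2 * k choose k))"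
        by (subst (asm) mult_cancel1) simp
      then have "real (Suc k * (Suc (Suc (2 * k)) choose Suc k)) = real (2 * (Suc (2 * k) * (2 * k choose k)))"
        by (rule arg_cong)
      then show ?thesis
        by (simp add: algebra_simps)
    qed
    then have "real ((2 * Suc k) choose Suc k) = 2 * (2 * real k + 1) / (real k + 1) * real ((2 * k) choose k)"
      by (simp add: field_simps)
    moreover have "1 / 4 ^ Suc k * (2 * (2 * real k + 1) / (real k + 1) * X) =
        (2 * real k + 1) / (2 * real k + 2) * (1 / 4 ^ k * X)" for X
      by (simp add: divide_simps) (simp add: algebra_simps)
    ultimately have "1 / 4 ^ Suc k * real ((2 * Suc k) choose Suc k) =
      (2 * real k + 1) / (2 * real k + 2) * (1 / 4 ^ k * real ((2 * k) choose k))"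
      by metis
    then show ?case
      unfolding Suc.IH acoef_Suc .
  qed simp
  then show "b_coeff (2 * k) = acoef k" "b_coeff (2 * k + 1) = acoef k"
    unfolding b_coeff_even b_coeff_odd by simp_all
qed

text \<open>Product to sum: \<open>2 * cos x\<close> splits the term with frequency
  \<open>4 * j + 1\<close> into those with \<open>4 * j\<close> and \<open>4 * j + 2\<close>, which
  carry equal coefficients.\<close>

lemma cos_sum_eq_jacobi_sum: "(\<Sum>k\<le>2 * n + 1. b_coeff k * cos (real k * (2 * x))) = 2 * cos x * jacobi_sum n x"
proof (induction n)
  case 0
  have "b_coeff 0 = 1" "b_coeff (Suc 0) = 1"
    by (simp_all add: b_coeff_def)
  then show ?case
    by (simp add: jacobi_sum_def cos_double_cos power2_eq_square)
next
  case (Suc n)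
  have b: "b_coeff (Suc (Suc (2 * n))) = acoef (Suc n)" "b_coeff (Suc (Suc (Suc (2 * n)))) = acoef (Suc n)"
    using acoef_eq_b_coeff[of "Suc n"] by simp_all
  define t where "t = real (4 * Suc n + 1) * x"
  have "cos (t - x) + cos (t + x) = 2 * cos x * cos t"
    by (simp add: cos_add cos_diff)
  moreover have "t - x = real (Suc (Suc (2 * n))) * (2 * x)" "t + x = real (Suc (Suc (Suc (2 * n)))) * (2 * x)"
    by (simp_all add: t_def algebra_simps)
  ultimately have "acoef (Suc n) * cos (real (Suc (Suc (2 * n))) * (2 * x)) +
      acoef (Suc n) * cos (real (Suc (Suc (Suc (2 * n)))) * (2 * x)) = 2 * cos x * (acoef (Suc n) * cos t)"
    by (metis distrib_left mult.left_commute)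
  moreover have "jacobi_sum (Suc n) x = jacobi_sum n x + acoef (Suc n) * cos t"
    by (simp add: jacobi_sum_def t_def)
  moreover have "2 * Suc n + 1 = Suc (Suc (2 * n + 1))"
    by simp
  ultimately show ?case
    using Suc.IH by (simp add: b distrib_left del: of_nat_Suc)
qed

text \<open>The numbers \<open>2048 b\<^sub>k\<close>.\<close>
definition coeffs :: "int list" where
  "coeffs = [2048, 2048, 1024, 1024, 768, 768, 640, 640, 560, 560, 504, 504, 462, 462, 429, 429]"

lemma coeffs_nth: "k < 16 \<Longrightarrow> b_coeff k = of_int (coeffs ! k) / 2048"
proof -
  assume "k < 16"
  have coeffs: "\<forall>j<8. of_int (coeffs ! (2 * j)) / 2048 = acoef j \<and> of_int (coeffs ! (2 * j + 1)) / 2048 = acoef j"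
    by (simp add: coeffs_def All_less_Suc2 eval_nat_numeral acoef_Suc)
  define j where "j = k div 2"
  have "j < 8" "k = 2 * j \<or> k = 2 * j + 1"
    using \<open>k < 16\<close> by (auto simp: j_def)
  then show ?thesis
    using coeffs acoef_eq_b_coeff[of j] by metis
qed

text \<open>The multipliers clear all denominators: \<open>2048\<close> from \<open>coeffs\<close>,
  \<open>D^N\<close> from the scaled polynomial, \<open>Q^2\<close> from the arccosine bounds and
  \<open>den\<close> from the constant.\<close>

definition cos_sum_check :: "int \<Rightarrow> int \<Rightarrow> int \<Rightarrow> int \<Rightarrow> nat \<Rightarrow> (int \<times> int) list \<Rightarrow> bool" where
  "cos_sum_check D Q num den N ks \<longleftrightarrow> chords_check (cos_sum_poly D (take (Suc N) coeffs))
     (den * Q\<^sup>2) (2048 * num * D ^ N) ks"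

lemma cos_sum_ge_if_check:
  assumes check: "cos_sum_check D Q num den N ks" and knots: "list_all (knot_check D Q) ks"
    and ks: "ks \<noteq> []" "tl ks \<noteq> []" "fst (hd ks) = - D" "fst (last ks) = D"
    and pos: "0 < D" "0 < Q" "0 \<le> num" "0 < den" and "N < 16" and y: "0 \<le> y" "y \<le> pi"
  shows "of_int num / of_int den * (pi - y)\<^sup>2 \<le> (\<Sum>k\<le>N. b_coeff k * cos (real k * y))"
proof -
  define C where "C = (\<Sum>k\<le>N. b_coeff k * cos (real k * y))"
  obtain b bs where bs: "take (Suc N) coeffs = b # bs"
    by (simp add: coeffs_def)
  have len: "length bs = N"
    using arg_cong[OF bs, of length] \<open>N < 16\<close> by (simp add: coeffs_def)
  have "horner (cos_sum_poly D (b # bs)) (of_int D * cos y) =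
    of_int D ^ N * (\<Sum>j\<le>N. of_int ((b # bs) ! j) * cos (real j * y))"
    using horner_cos_sum_poly[of D b bs y] pos by (simp add: len)
  also have "(\<Sum>j\<le>N. of_int ((b # bs) ! j) * cos (real j * y)) = (\<Sum>j\<le>N. 2048 * (b_coeff j * cos (real j * y)))"
    unfolding bs [symmetric] using \<open>N < 16\<close> by (intro sum.cong) (auto simp: coeffs_nth)
  also have "\<dots> = 2048 * C"
    by (simp add: C_def sum_distrib_left)
  finally have horner_eq: "horner (cos_sum_poly D (b # bs)) (of_int D * cos y) = of_int D ^ N * (2048 * C)" .
  \<comment> \<open>This identity turns the certified arccosine inequality at
    \<open>c = cos y\<close> into one about pi - y.\<close>
  have acos: "arccos (- cos y) = pi - y"
    using y arccos_minus[of "cos y"] by (simp add: arccos_cos)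
  have "of_int (2048 * num * D ^ N) * (of_int Q * arccos (- cos y))\<^sup>2 \<le>
    of_int (den * Q\<^sup>2) * horner (cos_sum_poly D (b # bs)) (of_int D * cos y)"
  proof (rule chords_check_sound[OF _ _ knots])
    show "chords_check (cos_sum_poly D (b # bs)) (den * Q\<^sup>2) (2048 * num * D ^ N) ks"
      using check by (simp add: cos_sum_check_def bs)
    have "of_int D * (- 1) \<le> of_int D * cos y"
      using pos by (intro mult_left_mono) auto
    then show "of_int (fst (hd ks)) \<le> of_int D * cos y"
      using ks by simp
  qed (use ks pos in auto)
  then have "(2048 * of_int D ^ N * of_int Q ^ 2) * (of_int num * (pi - y)\<^sup>2) \<le>
    (2048 * of_int D ^ N * of_int Q ^ 2) * (of_int den * C)"
    unfolding horner_eq acos by (simp add: power_mult_distrib mult_ac)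
  then have "of_int num * (pi - y)\<^sup>2 \<le> of_int den * C"
    by (rule mult_left_le_imp_le) (use pos in auto)
  then show ?thesis
    using pos by (simp add: C_def field_simps)
qed

text \<open>Both knot lists were found by a greedy search for the longest admissible chords. The second is very
  fine near \<open>z / D = 0.7475\<close>, where \<open>T\<^sub>6(t) / (t - \<pi>)\<^sup>2\<close> has its minimum.\<close>
definition knots_odd :: "(int \<times> int) list" where
  "knots_odd = [(-256, 0), (-249, 121), (-240, 182), (-222, 267), (-195, 361), (-160, 459),
     (-118, 559), (-79, 644), (-35, 735), (8, 821), (57, 920), (93, 995), (122, 1059), (150, 1125),
     (161, 1153), (166, 1166), (171, 1179), (190, 1233), (200, 1264), (204, 1277), (206, 1284),
     (209, 1294), (220, 1334), (224, 1350), (232, 1386), (238, 1416), (243, 1445), (251, 1508), (256, 1609)]"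

definition knots_T6 :: "(int \<times> int) list" where
  "knots_T6 = [(-4096, 0), (-3820, 12098), (-2963, 24973), (-1580, 38496), (-430, 48026),
     (2067, 68805), (2758, 75679), (2930, 77592), (2998, 78380), (3030, 78758), (3045, 78937),
     (3053, 79033), (3057, 79081), (3060, 79117), (3064, 79165), (3163, 80384), (4096, 102944)]"

lemma knot_check_odd: "list_all (knot_check 256 512) knots_odd"
  by (simp add: knots_odd_def knot_check_def cos_upper_def Let_def power2_eq_square)

lemma knot_check_T6: "list_all (knot_check 4096 32768) knots_T6"
  by (simp add: knots_T6_def knot_check_def cos_upper_def Let_def power2_eq_square)

text \<open>One knot list serves all odd degrees up to 15; degree 6, where \<open>0.123\<close>
  would fail, is not among them.\<close>

lemma cos_sum_check_odd: "list_all (\<lambda>n. cos_sum_check 256 512 123 1000 (2 * n + 1) knots_odd) [0..<8]"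
  by code_simp

text \<open>The constant \<open>0.1229\<close> is within 10^(-5) of the true minimum, hence the
  finer scales.\<close>

lemma cos_sum_check_T6: "cos_sum_check 4096 32768 1229 10000 6 knots_T6"
  by code_simp

lemma cos_sum_ge_odd:
  assumes "n < 8" "0 \<le> y" "y \<le> pi"
  shows "0.123 * (pi - y)\<^sup>2 \<le> (\<Sum>k\<le>2 * n + 1. b_coeff k * cos (real k * y))"
proof -
  have "cos_sum_check 256 512 123 1000 (2 * n + 1) knots_odd"
    using cos_sum_check_odd assms by (simp add: list_all_iff)
  from cos_sum_ge_if_check[OF this knot_check_odd] show ?thesis
    using assms by (simp add: knots_odd_def)
qed

lemma parabola_bound_le_jacobi_sum:
  assumes x: "0 < x" "x < pi / 2"
  shows "parabola_bound x \<le> jacobi_sum n x"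
proof -
  have small: "parabola_bound x \<le> jacobi_sum k x" if "k < 8" for k
  proof -
    have "0.123 * (pi - 2 * x)\<^sup>2 \<le> 2 * cos x * jacobi_sum k x"
      using cos_sum_ge_odd[of k "2 * x"] cos_sum_eq_jacobi_sum[of x k] that x by simp
    moreover have "0 < cos x"
      using x by (intro cos_gt_zero) auto
    ultimately show ?thesis
      by (simp add: parabola_bound_def pos_divide_le_eq mult_ac)
  qed
  show ?thesis
    using small[of n] parabola_bound_le_jacobi_sum_large[of n x] small[of 0] x by fastforce
qed

lemma T6_eq: "T6 t = (\<Sum>k\<le>6. b_coeff k * cos (real k * t))"
  by (simp add: T6_def atLeast0AtMost)

lemma T6_eq_coeffs: "T6 t = (\<Sum>k\<le>6. of_int (coeffs ! k) / 2048 * cos (real k * t))"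
  unfolding T6_eq by (intro sum.cong) (auto simp: coeffs_nth)

lemma T6_ge:
  assumes "0 \<le> t" "t \<le> pi"
  shows "0.1229 * (pi - t)\<^sup>2 \<le> T6 t"
  using cos_sum_ge_if_check[OF cos_sum_check_T6 knot_check_T6] assms by (simp add: knots_T6_def T6_eq)

section \<open>The minimum of the quotient\<close>

lemma continuous_on_T6 [continuous_intros]: "continuous_on A T6"
  unfolding T6_def [abs_def] by (intro continuous_intros)

text \<open>Since \<open>T6 pi\<close> is positive, the quotient tends to infinity at pi, so the
  minimum over a compact initial interval is the global one.\<close>

lemma T6_ratio_attains_minimum: "\<exists>t\<in>{0..<pi}. \<forall>s\<in>{0..<pi}. T6 t / (t - pi)\<^sup>2 \<le> T6 s / (s - pi)\<^sup>2"
proof -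
  define f where "f t = T6 t / (t - pi)\<^sup>2" for t
  have "filterlim f at_top (at_left pi)"
    unfolding f_def
  proof (rule LIM_at_top_divide)
    have "isCont T6 pi"
      using continuous_on_T6[of UNIV] by (simp add: continuous_on_eq_continuous_at)
    then show "(T6 \<longlongrightarrow> T6 pi) (at_left pi)"
      by (simp add: isCont_def filterlim_at_split)
    show "0 < T6 pi"
      unfolding T6_eq_coeffs cos_npi by (simp add: eval_nat_numeral coeffs_def)
    have "((\<lambda>t. (t - pi)\<^sup>2) \<longlongrightarrow> (pi - pi)\<^sup>2) (at_left pi)"
      by (intro tendsto_intros)
    then show "((\<lambda>t. (t - pi)\<^sup>2) \<longlongrightarrow> 0) (at_left pi)"
      by simp
    show "\<forall>\<^sub>F t in at_left pi. 0 < (t - pi)\<^sup>2"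
      by (auto simp: eventually_at_filter)
  qed
  then have "\<forall>\<^sub>F t in at_left pi. f 0 \<le> f t"
    by (simp add: filterlim_at_top)
  then obtain c where c: "c < pi" "\<And>t. c < t \<Longrightarrow> t < pi \<Longrightarrow> f 0 \<le> f t"
    by (auto simp: eventually_at_left_field)
  \<comment> \<open>The maximum keeps 0 in the compact interval, where it serves as comparison point
    for all later arguments.\<close>
  define d where "d = max c 0"
  have d: "0 \<le> d" "d < pi"
    using c by (auto simp: d_def)
  have "\<exists>t\<in>{0..d}. \<forall>s\<in>{0..d}. f t \<le> f s"
  proof (rule continuous_attains_inf)
    show "continuous_on {0..d} f"
      unfolding f_def using d by (intro continuous_intros) auto
  qed (use d in auto)
  then obtain t where t: "t \<in> {0..d}" "\<And>s. s \<in> {0..d} \<Longrightarrow> f t \<le> f s"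
    by blast
  have "f t \<le> f s" if "s \<in> {0..<pi}" for s
  proof (cases "s \<le> d")
    case False
    then have "f 0 \<le> f s"
      using that by (intro c) (auto simp: d_def)
    then show ?thesis
      using t(2)[of 0] d by simp
  qed (use t that in auto)
  then show ?thesis
    using t d by (intro bexI[of _ t]) (auto simp: f_def)
qed

text \<open>The point \<open>arccos 0.7475\<close> is close to the minimizer.\<close>
lemma T6_ratio_less: "\<exists>t\<in>{0..<pi}. T6 t / (t - pi)\<^sup>2 < 0.12291"
proof (rule bexI)
  define t where "t = arccos 0.7475"
  have cos_t: "cos t = 0.7475"
    by (simp add: t_def)
  define C where "C k = cos (real k * t)" for k
  have C_rec: "C (Suc (Suc k)) = 2 * 0.7475 * C (Suc k) - C k" for k
    using cos_times_Suc_Suc[of k t] by (simp add: C_def cos_t)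
  have C_base: "C 0 = 1" "C (Suc 0) = 0.7475"
    by (simp_all add: C_def cos_t)
  have "T6 t < 0.12291 * 2.41507\<^sup>2"
    unfolding T6_eq_coeffs C_def [symmetric]
    by (simp add: eval_nat_numeral coeffs_def C_rec C_base)
  \<comment> \<open>The number \<open>2.41507\<close> is a rational lower bound for pi - t, the
    arccosine of \<open>- 0.7475\<close>.\<close>
  also have "0.12291 * 2.41507\<^sup>2 \<le> 0.12291 * (pi - t)\<^sup>2"
  proof -
    have "- 0.7475 \<le> cos (2.41507 :: real)"
      using cos_ge_cos_upper[of "2.41507"]
      by (simp add: cos_upper_def power2_eq_square power_divide fact_numeral)
    then have "arccos (cos 2.41507) \<le> arccos (- 0.7475)"
      by (intro arccos_le_arccos) auto
    moreover have "arccos (cos 2.41507) = 2.41507"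
      using pi_approx by (intro arccos_cos) auto
    moreover have "arccos (- 0.7475) = pi - t"
      unfolding t_def by (rule arccos_minus) auto
    ultimately show ?thesis
      by (intro mult_left_mono power_mono) auto
  qed
  also have "(pi - t)\<^sup>2 = (t - pi)\<^sup>2"
    by (rule power2_commute)
  finally have "T6 t < 0.12291 * (t - pi)\<^sup>2" .
  moreover show "t \<in> {0..<pi}"
    unfolding t_def using arccos_lt_bounded[of "0.7475"] by auto
  ultimately show "T6 t / (t - pi)\<^sup>2 < 0.12291"
    by (simp add: pos_divide_less_eq)
qed

theorem mainTheorem2:
  shows "\<exists>\<alpha>::real.
           is_minimum_on \<alpha> (\<lambda>t. T6 t / (t - pi)\<^sup>2) {0..<pi} \<and>
           0.12290 \<le> \<alpha> \<and> \<alpha> < 0.12291 \<and>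
           (\<forall>(n::nat) (x::real). 0 < x \<and> x < pi / 2 \<longrightarrow>
              (\<Sum>k=0..n. 1 / fact k * pochhammer (1 / 2) k *
                  (jacobi_P (4 * k + 1) (- 1 / 2) (- 1 / 2) (cos x) /
                   jacobi_P (4 * k + 1) (- 1 / 2) (- 1 / 2) 1))
              \<ge> \<alpha> * (pi - 2 * x)\<^sup>2 / (2 * cos x))"
proof -
  obtain t where t: "t \<in> {0..<pi}"
    and min: "\<And>s. s \<in> {0..<pi} \<Longrightarrow> T6 t / (t - pi)\<^sup>2 \<le> T6 s / (s - pi)\<^sup>2"
    using T6_ratio_attains_minimum by blast
  define \<alpha> where "\<alpha> = T6 t / (t - pi)\<^sup>2"
  have "is_minimum_on \<alpha> (\<lambda>t. T6 t / (t - pi)\<^sup>2) {0..<pi}"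
    using t min by (auto simp: is_minimum_on_def \<alpha>_def)
  moreover have "0.12290 \<le> \<alpha>"
    using T6_ge[of t] t by (simp add: \<alpha>_def pos_le_divide_eq power2_commute[of t])
  moreover have less: "\<alpha> < 0.12291"
  proof -
    obtain s where "s \<in> {0..<pi}" "T6 s / (s - pi)\<^sup>2 < 0.12291"
      using T6_ratio_less by blast
    then show ?thesis
      unfolding \<alpha>_def using min le_less_trans by blast
  qed
  moreover have "\<alpha> * (pi - 2 * x)\<^sup>2 / (2 * cos x) \<le>
      (\<Sum>k=0..n. 1 / fact k * pochhammer (1 / 2) k *
        (jacobi_P (4 * k + 1) (- 1 / 2) (- 1 / 2) (cos x) / jacobi_P (4 * k + 1) (- 1 / 2) (- 1 / 2) 1))"
    if x: "0 < x" "x < pi / 2" for n x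
  proof -
    have "0 < cos x"
      using x by (intro cos_gt_zero) auto
    \<comment> \<open>The minimum lies below \<open>0.12291\<close>, hence below the constant
      \<open>0.123\<close> in \<open>parabola_bound\<close>.\<close>
    then have "\<alpha> * (pi - 2 * x)\<^sup>2 / (2 * cos x) \<le> parabola_bound x"
      unfolding parabola_bound_def using less by (intro divide_right_mono mult_right_mono) auto
    also have "\<dots> \<le> jacobi_sum n x"
      using x by (rule parabola_bound_le_jacobi_sum)
    also have "\<dots> = (\<Sum>k=0..n. 1 / fact k * pochhammer (1 / 2) k *
        (jacobi_P (4 * k + 1) (- 1 / 2) (- 1 / 2) (cos x) / jacobi_P (4 * k + 1) (- 1 / 2) (- 1 / 2) 1))"
      by (simp only: jacobi_P_half_ratio) (simp add: jacobi_sum_def acoef_def atLeast0AtMost)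
    finally show ?thesis .
  qed
  ultimately show ?thesis
    by blast
qed

end
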